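(* Let $F$ be a strictly finite 1-sorted species and $G=G(X,Y)$ a 2-sorted species, and let $F\boxtimes_Y G$ be their inner plethysm in $Y$. Fix $n\ge 0$ and define a function $\chi$ on $\mathfrak{S}_n$, with values in the ring of symmetric functions in $x_1,x_2,\dots$, by $$\chi(\sigma)=\mathrm{fix}_w\,G_{X[Y]}(\mathbb{P}_x,\sigma)=\sum_{\lambda}\mathrm{fix}\,G[\lambda,\mu]\,\frac{p_\lambda(x)}{z_\lambda},$$ where $\mu$ is the cycle type of $\sigma$ and $\lambda$ runs over all partitions. Then for every $\sigma\in\mathfrak{S}_n$, $$\mathrm{fix}_w\,(F\boxtimes_Y G)_{X[Y]}(\mathbb{P}_x,\sigma)=Z_F[\chi](\sigma).$$
   Context: $\mathbb{B}$ is the category of finite sets and bijections; a 1-sorted species is a functor $\mathbb{B}\to\mathbb{B}$ and a 2-sorted species is a functor $\mathbb{B}^2\to\mathbb{B}$. $[n]=\{1,\dots,n\}$, $F[n]=F[[n]]$, and $F$ is strictly finite if $F[n]=\emptyset$ for all large $n$. For a commutative ring $R\supseteq\mathbb{Q}$ (with a notion of convergent infinite sums), $\mathrm{Sets}_R$ is the category of pairs $(A,w)$, $A$ a set and $w:A\to R$ a weight function such that $\sum_{a\in A}w(a)$ exists in $R$, with weight-preserving functions as morphisms. Here $R=\mathbb{Q}[[x_1,x_2,\dots]]$, and $\mathbb{P}_x$ is the set of positive integers with $w(i)=x_i$. For $A\in\mathrm{Sets}_R$ and a function $f:[m]\to A$, $w(f)=w(f(1))\cdots w(f(m))$. The analytic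 functor in $X$ of a 2-sorted species $G$ is $G_{X[Y]}(A,B)=\sum_{m\ge0}\bigl(G[m,B]\times A^m\bigr)/\mathfrak{S}_m$ for $A\in\mathrm{Sets}_R$ and $B$ a finite set, where $\mathfrak{S}_m$ acts by $\tau\cdot(t,f)=(G[\tau,1_B](t),f\circ\tau^{-1})$ and the orbit of $(t,f)$ has weight $w(f)$; bijections of $B$ act through $G$. For a permutation $\sigma$ of $[n]$, $\mathrm{fix}_w\,G_{X[Y]}(\mathbb{P}_x,\sigma)$ is the sum of the weights of the elements of $G_{X[Y]}(\mathbb{P}_x,[n])$ fixed by $\sigma$. The analytic functor of a 1-sorted species $F$ is $F(A)=\sum_{m\ge0}(F[m]\times A^m)/\mathfrak{S}_m$ for $A\in\mathrm{Sets}_R$, with action $\tau\cdot(t,f)=(F[\tau](t),f\circ\tau^{-1})$ and the orbit of $(t,f)$ having weight $w(f)$. The inner plethysm in $Y$, $F\boxtimes_Y G$, is the 2-sorted species $H$ with $H_{X[Y]}(A,B)\cong F(G_{X[Y]}(A,B))$ naturally in $A,B$. $\mathrm{fix}\,F[\lambda]$ is the number of fixed points of $F[\sigma]$ for $\sigma$ of cycle type $\lambda$; $\mathrm{fix}\,G[\lambda,\mu]$ is the number of fixed points of $G[\tau,\sigma]$ for $\tau,\sigma$ of cycle types $\lambda,\mu$. $Z_F=\sum_\lambda\mathrm{fix}\,F[\lambda]\frac{p_\lambda}{z_\lambda}$, where $p_\lambda$ are power sums and $z_\lambda=\prod_i i^{m_i}m_i!$ for $\lambda=(1^{m_1}2^{m_2}\cdots)$;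 $p_\lambda(x)$ is $p_\lambda$ in the variables $x_1,x_2,\dots$. Class functions $c$ on $\mathfrak{S}_n$ with values in symmetric functions in the $x_i$ (possibly of unbounded degree) form a ring under pointwise operations, with Adams operations $(\psi^k c)(\sigma)=p_k\circ\bigl(c(\sigma^k)\bigr)$, where $p_k\circ g$ is obtained from $g$ by replacing every $x_j$ with $x_j^k$. For a symmetric function $f$ of bounded degree, $f[\chi]$ is obtained by writing $f$ as a polynomial in the $p_k$ and substituting $\psi^k(\chi)$ for $p_k$. *)

theory Defs
  imports
    Complex_Main
    "HOL-Library.Multiset"
    "HOL-Library.FuncSet"
    "HOL-Library.Poly_Mapping"
    "HOL-Combinatorics.Permutations"
    "HOL-Combinatorics.Orbits"
begin

section \<open>Power series over the rationals in arbitrarily many variables\<close>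

text \<open>A monomial is a finite multiset of variables; the ring \<open>\<rat>[[x\<^sub>1, x\<^sub>2, \<dots>]]\<close> is
  \<open>num mps\<close>, where the HOL type \<^typ>\<open>num\<close> (the binary numerals) serves as the type of
  positive integers.\<close>

typedef 'v mps = "UNIV :: ('v multiset \<Rightarrow> rat) set"
  morphisms mps_coeff Abs_mps ..

setup_lifting type_definition_mps

lemma mps_eqI: "(\<And>m. mps_coeff f m = mps_coeff g m) \<Longrightarrow> f = g"
  by transfer auto

lemma finite_mset_splits: "finite {(a, b). a + b = (m :: 'v multiset)}"
proof -
  let ?L = "{xs. set xs \<subseteq> set_mset m \<and> length xs \<le> size m}"
  have "a \<in> mset ` ?L \<and> b \<in> mset ` ?L" if "a + b = m" for a b
  proof -
    obtain xs ys where "a = mset xs" "b = mset ys" by (metis ex_mset)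
    with that show ?thesis by auto
  qed
  then have "{(a, b). a + b = m} \<subseteq> (mset ` ?L) \<times> (mset ` ?L)" by blast
  moreover have "finite (mset ` ?L)"
    by (intro finite_imageI finite_lists_length_le) simp
  ultimately show ?thesis by (meson finite_SigmaI finite_subset)
qed

instantiation mps :: (type) comm_ring_1
begin

lift_definition zero_mps :: "'v mps" is "\<lambda>_. 0" .
lift_definition one_mps :: "'v mps" is "\<lambda>m. if m = {#} then 1 else 0" .
lift_definition plus_mps :: "'v mps \<Rightarrow> 'v mps \<Rightarrow> 'v mps" is "\<lambda>f g m. f m + g m" .
lift_definition minus_mps :: "'v mps \<Rightarrow> 'v mps \<Rightarrow> 'v mps" is "\<lambda>f g m. f m - g m" .
lift_definition uminus_mps :: "'v mps \<Rightarrow> 'v mps" is "\<lambda>f m. - f m" .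
lift_definition times_mps :: "'v mps \<Rightarrow> 'v mps \<Rightarrow> 'v mps"
  is "\<lambda>f g m. \<Sum>(a, b) | a + b = m. f a * g b" .

instance
proof
  fix f g h :: "'v mps"
  show "f * g * h = f * (g * h)"
  proof (transfer, rule ext)
    fix f g h :: "'v multiset \<Rightarrow> rat" and m
    let ?S = "\<lambda>m. {(a, b). a + b = (m :: 'v multiset)}"
    have "(\<Sum>(a, b)\<in>?S m. (\<Sum>(c, d)\<in>?S a. f c * g d) * h b)
        = (\<Sum>p\<in>?S m. \<Sum>q\<in>?S (fst p). f (fst q) * g (snd q) * h (snd p))"
      by (simp add: case_prod_unfold sum_distrib_right)
    also have "\<dots> = (\<Sum>(p, q)\<in>Sigma (?S m) (\<lambda>p. ?S (fst p)).
        f (fst q) * g (snd q) * h (snd p))"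
      by (intro sum.Sigma ballI) (auto intro: finite_mset_splits)
    also have "\<dots> = (\<Sum>(p, q)\<in>Sigma (?S m) (\<lambda>p. ?S (snd p)).
        f (fst p) * (g (fst q) * h (snd q)))"
      by (rule sum.reindex_bij_witness
          [of _ "\<lambda>((a, b), (c, d)). ((a + c, d), (a, c))"
                "\<lambda>((a, b), (c, d)). ((c, d + b), (d, b))"])
         (auto simp: add_ac mult_ac)
    also have "\<dots> = (\<Sum>p\<in>?S m. \<Sum>q\<in>?S (snd p). f (fst p) * (g (fst q) * h (snd q)))"
      by (intro sum.Sigma[symmetric] ballI) (auto intro: finite_mset_splits)
    also have "\<dots> = (\<Sum>(a, b)\<in>?S m. f a * (\<Sum>(c, d)\<in>?S b. g c * h d))"
      by (simp add: case_prod_unfold sum_distrib_left)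
    finally show "(\<Sum>(a, b)\<in>?S m. (\<Sum>(c, d)\<in>?S a. f c * g d) * h b)
        = (\<Sum>(a, b)\<in>?S m. f a * (\<Sum>(c, d)\<in>?S b. g c * h d))" .
  qed
  show "f * g = g * f"
  proof (transfer, rule ext)
    fix f g :: "'v multiset \<Rightarrow> rat" and m
    show "(\<Sum>(a, b) | a + b = m. f a * g b) = (\<Sum>(a, b) | a + b = m. g a * f b)"
      by (rule sum.reindex_bij_witness[of _ prod.swap prod.swap])
         (auto simp: add.commute)
  qed
  show "1 * f = f"
  proof (transfer, rule ext)
    fix f :: "'v multiset \<Rightarrow> rat" and m
    have "(\<Sum>(a, b) | a + b = m. (if a = {#} then 1 else 0) * f b)
        = (\<Sum>(a, b)\<in>{({#} :: 'v multiset, m)}. (if a = {#} then 1 else 0) * f b)"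
      by (rule sum.mono_neutral_right) (auto intro: finite_mset_splits split: if_splits)
    then show "(\<Sum>(a, b) | a + b = m. (if a = {#} then 1 else 0) * f b) = f m" by simp
  qed
  show "(f + g) * h = f * h + g * h"
    by transfer (simp add: case_prod_unfold sum.distrib algebra_simps)
  show "(0 :: 'v mps) \<noteq> 1"
    by transfer (auto simp: fun_eq_iff)
qed (transfer; simp add: fun_eq_iff; fail)+

end

lift_definition mps_const :: "rat \<Rightarrow> 'v mps" is "\<lambda>c m. if m = {#} then c else 0" .

lift_definition mps_var :: "'v \<Rightarrow> 'v mps" is "\<lambda>i m. if m = {#i#} then 1 else 0" .

text \<open>Convergence of an infinite sum is coefficientwise: every monomial occurs in only
  finitely many of the summands.  For a family that is not summable, \<open>mps_sum\<close> has no meaning.\<close>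

definition mps_summable :: "'a set \<Rightarrow> ('a \<Rightarrow> 'v mps) \<Rightarrow> bool" where
  "mps_summable A w \<longleftrightarrow> (\<forall>m. finite {a \<in> A. mps_coeff (w a) m \<noteq> 0})"

lift_definition mps_sum :: "'a set \<Rightarrow> ('a \<Rightarrow> 'v mps) \<Rightarrow> 'v mps"
  is "\<lambda>A w m. \<Sum>a | a \<in> A \<and> w a m \<noteq> 0. w a m" .

text \<open>\<open>pth_plethysm k g\<close> is \<open>p\<^sub>k \<circ> g\<close>, the series obtained from \<open>g\<close> by replacing each
  variable by its \<open>k\<close>-th power (\<open>k \<ge> 1\<close>); the sum has at most one term.\<close>

lift_definition pth_plethysm :: "nat \<Rightarrow> 'v mps \<Rightarrow> 'v mps"
  is "\<lambda>k g m. \<Sum>m' | repeat_mset k m' = m. g m'" .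

text \<open>Symmetric functions, possibly of unbounded degree.\<close>

definition mps_symmetric :: "'v mps \<Rightarrow> bool" where
  "mps_symmetric f \<longleftrightarrow>
     (\<forall>\<pi>. bij \<pi> \<longrightarrow> (\<forall>m. mps_coeff f (image_mset \<pi> m) = mps_coeff f m))"


section \<open>Species\<close>

text \<open>The category of finite sets and bijections is represented by the finite sets of natural
  numbers.  \<open>Transp F U \<sigma>\<close> is \<open>F[\<sigma>] : F[U] \<rightarrow> F[V]\<close> for a bijection \<open>\<sigma> : U \<rightarrow> V\<close>; it is relevant
  only on \<open>F[U]\<close> and depends only on the values of \<open>\<sigma>\<close> on \<open>U\<close>.\<close>

record 's species =
  Struct :: "nat set \<Rightarrow> 's set"
  Transp :: "nat set \<Rightarrow> (nat \<Rightarrow> nat) \<Rightarrow> 's \<Rightarrow> 's"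

definition is_species :: "'s species \<Rightarrow> bool" where
  "is_species F \<longleftrightarrow>
     (\<forall>U. finite U \<longrightarrow> finite (Struct F U)) \<and>
     (\<forall>U V \<sigma>. finite U \<and> bij_betw \<sigma> U V \<longrightarrow>
        bij_betw (Transp F U \<sigma>) (Struct F U) (Struct F V)) \<and>
     (\<forall>U \<sigma> \<sigma>'. finite U \<and> inj_on \<sigma> U \<and> (\<forall>u\<in>U. \<sigma> u = \<sigma>' u) \<longrightarrow>
        (\<forall>s\<in>Struct F U. Transp F U \<sigma> s = Transp F U \<sigma>' s)) \<and>
     (\<forall>U. finite U \<longrightarrow> (\<forall>s\<in>Struct F U. Transp F U id s = s)) \<and>
     (\<forall>U V W \<sigma> \<tau>. finite U \<and> bij_betw \<sigma> U V \<and> bij_betw \<tau> V W \<longrightarrow>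
        (\<forall>s\<in>Struct F U. Transp F U (\<tau> \<circ> \<sigma>) s = Transp F V \<tau> (Transp F U \<sigma> s)))"

definition strictly_finite :: "'s species \<Rightarrow> bool" where
  "strictly_finite F \<longleftrightarrow> (\<exists>N. \<forall>n\<ge>N. Struct F {1..n} = {})"

record 's species2 =
  Struct2 :: "nat set \<Rightarrow> nat set \<Rightarrow> 's set"
  Transp2 :: "nat set \<Rightarrow> nat set \<Rightarrow> (nat \<Rightarrow> nat) \<Rightarrow> (nat \<Rightarrow> nat) \<Rightarrow> 's \<Rightarrow> 's"

definition is_species2 :: "'s species2 \<Rightarrow> bool" where
  "is_species2 G \<longleftrightarrow>
     (\<forall>U B. finite U \<and> finite B \<longrightarrow> finite (Struct2 G U B)) \<and>
     (\<forall>U V B C \<sigma> \<beta>. finite U \<and> finite B \<and> bij_betw \<sigma> U V \<and> bij_betw \<beta> B C \<longrightarrow>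
        bij_betw (Transp2 G U B \<sigma> \<beta>) (Struct2 G U B) (Struct2 G V C)) \<and>
     (\<forall>U B \<sigma> \<sigma>' \<beta> \<beta>'. finite U \<and> finite B \<and> inj_on \<sigma> U \<and> inj_on \<beta> B \<and>
          (\<forall>u\<in>U. \<sigma> u = \<sigma>' u) \<and> (\<forall>b\<in>B. \<beta> b = \<beta>' b) \<longrightarrow>
        (\<forall>s\<in>Struct2 G U B. Transp2 G U B \<sigma> \<beta> s = Transp2 G U B \<sigma>' \<beta>' s)) \<and>
     (\<forall>U B. finite U \<and> finite B \<longrightarrow> (\<forall>s\<in>Struct2 G U B. Transp2 G U B id id s = s)) \<and>
     (\<forall>U V W B C D \<sigma> \<tau> \<beta> \<gamma>. finite U \<and> finite B \<and> bij_betw \<sigma> U V \<and> bij_betw \<tau> V W \<and>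
          bij_betw \<beta> B C \<and> bij_betw \<gamma> C D \<longrightarrow>
        (\<forall>s\<in>Struct2 G U B. Transp2 G U B (\<tau> \<circ> \<sigma>) (\<gamma> \<circ> \<beta>) s =
           Transp2 G V C \<tau> \<gamma> (Transp2 G U B \<sigma> \<beta> s)))"


section \<open>Analytic functors\<close>

text \<open>An element of \<open>\<Sum>\<^sub>m (S\<^sub>m \<times> A\<^sup>m) / \<SS>\<^sub>m\<close> is a pair of \<open>m\<close> and an orbit of pairs \<open>(t, f)\<close>,
  where \<open>f : [m] \<rightarrow> A\<close> is extensional (undefined outside of \<open>{1..m}\<close>).\<close>

type_synonym ('s, 'a) analytic = "nat \<times> ('s \<times> (nat \<Rightarrow> 'a)) set"

definition sym_orbit ::
    "((nat \<Rightarrow> nat) \<Rightarrow> 's \<Rightarrow> 's) \<Rightarrow> nat \<Rightarrow> 's \<times> (nat \<Rightarrow> 'a) \<Rightarrow> ('s \<times> (nat \<Rightarrow> 'a)) set" where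
  "sym_orbit act m = (\<lambda>(t, f). {(act \<tau> t, f \<circ> inv \<tau>) | \<tau>. \<tau> permutes {1..m}})"

definition analytic_set ::
    "(nat \<Rightarrow> 's set) \<Rightarrow> (nat \<Rightarrow> (nat \<Rightarrow> nat) \<Rightarrow> 's \<Rightarrow> 's) \<Rightarrow> 'a set \<Rightarrow> ('s, 'a) analytic set" where
  "analytic_set S act A =
     (SIGMA m:UNIV. sym_orbit (act m) m ` (S m \<times> ({1..m} \<rightarrow>\<^sub>E A)))"

text \<open>\<open>w(f)\<close> is constant on an orbit.\<close>

definition analytic_weight :: "('a \<Rightarrow> 'v mps) \<Rightarrow> ('s, 'a) analytic \<Rightarrow> 'v mps" where
  "analytic_weight w = (\<lambda>(m, orb). \<Prod>i\<in>{1..m}. w (snd (SOME p. p \<in> orb) i))"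

definition analytic_map ::
    "(nat \<Rightarrow> 's \<Rightarrow> 's) \<Rightarrow> ('a \<Rightarrow> 'b) \<Rightarrow> ('s, 'a) analytic \<Rightarrow> ('s, 'b) analytic" where
  "analytic_map g h =
     (\<lambda>(m, orb). (m, (\<lambda>(t, f). (g m t, restrict (h \<circ> f) {1..m})) ` orb))"

text \<open>\<open>F(A)\<close> and \<open>F(h)\<close>.\<close>

definition species_app :: "'s species \<Rightarrow> 'a set \<Rightarrow> ('s, 'a) analytic set" where
  "species_app F A = analytic_set (\<lambda>m. Struct F {1..m}) (\<lambda>m. Transp F {1..m}) A"

definition species_app_map ::
    "'s species \<Rightarrow> ('a \<Rightarrow> 'b) \<Rightarrow> ('s, 'a) analytic \<Rightarrow> ('s, 'b) analytic" where
  "species_app_map F h = analytic_map (\<lambda>m t. t) h"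

text \<open>\<open>G\<^bsub>X[Y]\<^esub>(A, B)\<close> and \<open>G\<^bsub>X[Y]\<^esub>(h, \<beta>)\<close>, the latter for a bijection \<open>\<beta>\<close> with domain \<open>B\<close>.\<close>

definition species2_app :: "'s species2 \<Rightarrow> 'a set \<Rightarrow> nat set \<Rightarrow> ('s, 'a) analytic set" where
  "species2_app G A B =
     analytic_set (\<lambda>m. Struct2 G {1..m} B) (\<lambda>m \<tau>. Transp2 G {1..m} B \<tau> id) A"

definition species2_app_map ::
    "'s species2 \<Rightarrow> nat set \<Rightarrow> ('a \<Rightarrow> 'b) \<Rightarrow> (nat \<Rightarrow> nat) \<Rightarrow>
       ('s, 'a) analytic \<Rightarrow> ('s, 'b) analytic" where
  "species2_app_map G B h \<beta> = analytic_map (\<lambda>m. Transp2 G {1..m} B id \<beta>) h"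

definition weight_preserving ::
    "'a set \<Rightarrow> ('a \<Rightarrow> 'v mps) \<Rightarrow> 'b set \<Rightarrow> ('b \<Rightarrow> 'v mps) \<Rightarrow> ('a \<Rightarrow> 'b) \<Rightarrow> bool" where
  "weight_preserving A w A' w' h \<longleftrightarrow> h \<in> A \<rightarrow> A' \<and> (\<forall>a\<in>A. w' (h a) = w a)"

text \<open>\<open>H\<close> is an inner plethysm of \<open>F\<close> and \<open>G\<close> in \<open>Y\<close> if there are isomorphisms
  \<open>\<Phi>\<^bsub>(A,w),B\<^esub> : H\<^bsub>X[Y]\<^esub>(A, B) \<rightarrow> F(G\<^bsub>X[Y]\<^esub>(A, B))\<close> of weighted sets, natural in the weighted set
  \<open>(A, w)\<close> and the finite set \<open>B\<close>.  HOL cannot quantify over all weighted sets inside a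
  definition; \<open>A\<close> ranges over those carried by the positive integers, which contain an isomorphic
  copy of every countable one.\<close>

definition is_inner_plethysm :: "'f species \<Rightarrow> 'g species2 \<Rightarrow> 'h species2 \<Rightarrow> bool" where
  "is_inner_plethysm F G H \<longleftrightarrow> is_species2 H \<and>
     (\<exists>\<Phi> :: num set \<Rightarrow> (num \<Rightarrow> num mps) \<Rightarrow> nat set \<Rightarrow>
            ('h, num) analytic \<Rightarrow> ('f, ('g, num) analytic) analytic.
        (\<forall>A w B. mps_summable A w \<and> finite B \<longrightarrow>
           bij_betw (\<Phi> A w B) (species2_app H A B) (species_app F (species2_app G A B)) \<and>
           (\<forall>e\<in>species2_app H A B.
              analytic_weight (analytic_weight w) (\<Phi> A w B e) = analytic_weight w e)) \<and>
        (\<forall>A w A' w' h B B' \<beta>.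
           mps_summable A w \<and> mps_summable A' w' \<and> weight_preserving A w A' w' h \<and>
           finite B \<and> bij_betw \<beta> B B' \<longrightarrow>
           (\<forall>e\<in>species2_app H A B.
              \<Phi> A' w' B' (species2_app_map H B h \<beta> e) =
              species_app_map F (species2_app_map G B h \<beta>) (\<Phi> A w B e))))"

text \<open>\<open>fix\<^sub>w G\<^bsub>X[Y]\<^esub>(\<bbbP>\<^sub>x, \<sigma>)\<close> for a permutation \<open>\<sigma>\<close> of \<open>[n]\<close>; \<open>\<bbbP>\<^sub>x\<close> is the set of all positive
  integers with weights \<open>mps_var\<close>.\<close>

definition fix_weight :: "'s species2 \<Rightarrow> nat \<Rightarrow> (nat \<Rightarrow> nat) \<Rightarrow> num mps" where
  "fix_weight G n \<sigma> =
     mps_sum {e \<in> species2_app G (UNIV :: num set) {1..n}. species2_app_map G {1..n} id \<sigma> e = e}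
       (analytic_weight mps_var)"


section \<open>Cycle index\<close>

definition partitions :: "nat multiset set" where
  "partitions = {\<nu>. 0 \<notin># \<nu>}"

definition cycle_type :: "nat \<Rightarrow> (nat \<Rightarrow> nat) \<Rightarrow> nat multiset" where
  "cycle_type n \<sigma> = image_mset card (mset_set (orbit \<sigma> ` {1..n}))"

definition perm_of_type :: "nat multiset \<Rightarrow> nat \<Rightarrow> nat" where
  "perm_of_type \<nu> = (SOME \<sigma>. \<sigma> permutes {1..\<Sum>\<^sub># \<nu>} \<and> cycle_type (\<Sum>\<^sub># \<nu>) \<sigma> = \<nu>)"

definition fix_count :: "'s species \<Rightarrow> nat multiset \<Rightarrow> nat" where
  "fix_count F \<nu> =
     card {s \<in> Struct F {1..\<Sum>\<^sub># \<nu>}. Transp F {1..\<Sum>\<^sub># \<nu>} (perm_of_type \<nu>) s = s}"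

definition fix_count2 :: "'s species2 \<Rightarrow> nat multiset \<Rightarrow> nat multiset \<Rightarrow> nat" where
  "fix_count2 G \<nu> \<mu> =
     card {s \<in> Struct2 G {1..\<Sum>\<^sub># \<nu>} {1..\<Sum>\<^sub># \<mu>}.
             Transp2 G {1..\<Sum>\<^sub># \<nu>} {1..\<Sum>\<^sub># \<mu>} (perm_of_type \<nu>) (perm_of_type \<mu>) s = s}"

definition z_part :: "nat multiset \<Rightarrow> nat" where
  "z_part \<nu> = (\<Prod>i\<in>set_mset \<nu>. i ^ count \<nu> i * fact (count \<nu> i))"

definition power_sum :: "nat \<Rightarrow> 'v mps" where
  "power_sum k = mps_sum UNIV (\<lambda>i. mps_var i ^ k)"

definition power_sum_part :: "nat multiset \<Rightarrow> 'v mps" where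
  "power_sum_part \<nu> = (\<Prod>k\<in>#\<nu>. power_sum k)"

definition cycle_index :: "'s species \<Rightarrow> num mps" where
  "cycle_index F = mps_sum partitions
     (\<lambda>\<nu>. mps_const (of_nat (fix_count F \<nu>) / of_nat (z_part \<nu>)) * power_sum_part \<nu>)"


section \<open>Plethystic substitution of a class function\<close>

definition class_function :: "nat \<Rightarrow> ((nat \<Rightarrow> nat) \<Rightarrow> num mps) \<Rightarrow> bool" where
  "class_function n \<chi> \<longleftrightarrow>
     (\<forall>\<sigma>. \<sigma> permutes {1..n} \<longrightarrow> mps_symmetric (\<chi> \<sigma>)) \<and>
     (\<forall>\<sigma> \<pi>. \<sigma> permutes {1..n} \<and> \<pi> permutes {1..n} \<longrightarrow> \<chi> (\<pi> \<circ> \<sigma> \<circ> inv \<pi>) = \<chi> \<sigma>)"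

definition adams ::
    "nat \<Rightarrow> ((nat \<Rightarrow> nat) \<Rightarrow> num mps) \<Rightarrow> (nat \<Rightarrow> nat) \<Rightarrow> num mps" where
  "adams k \<chi> \<sigma> = pth_plethysm k (\<chi> (\<sigma> ^^ k))"

text \<open>A polynomial with rational coefficients in indeterminates indexed by the positive integers
  is an element of \<^typ>\<open>nat multiset \<Rightarrow>\<^sub>0 rat\<close> whose monomials are partitions.\<close>

definition poly_subst :: "(nat multiset \<Rightarrow>\<^sub>0 rat) \<Rightarrow> (nat \<Rightarrow> 'v mps) \<Rightarrow> 'v mps" where
  "poly_subst P v =
     (\<Sum>\<nu>\<in>Poly_Mapping.keys P. mps_const (Poly_Mapping.lookup P \<nu>) * (\<Prod>k\<in>#\<nu>. v k))"

text \<open>The polynomial expressing \<open>f\<close> in the \<open>p\<^sub>k\<close>; it is unique because these are algebraically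
  independent, and it exists precisely for symmetric functions of bounded degree.\<close>

definition power_sum_poly :: "num mps \<Rightarrow> (nat multiset \<Rightarrow>\<^sub>0 rat)" where
  "power_sum_poly f =
     (THE P. Poly_Mapping.keys P \<subseteq> partitions \<and> poly_subst P power_sum = f)"

text \<open>\<open>f[\<chi>]\<close>; the ring operations on class functions are pointwise.\<close>

definition plethysm :: "num mps \<Rightarrow> ((nat \<Rightarrow> nat) \<Rightarrow> num mps) \<Rightarrow> (nat \<Rightarrow> nat) \<Rightarrow> num mps" where
  "plethysm f \<chi> \<sigma> = poly_subst (power_sum_poly f) (\<lambda>k. adams k \<chi> \<sigma>)"

end

theory Submission
  imports Defs "HOL-Combinatorics.Cycles"
begin

text \<open>All weights involved are monomials, so every identity is a count of elements of a given degree.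
  Burnside's lemma, twisted by an automorphism \<open>\<phi>\<close> commuting with \<open>\<SS>\<^sub>m\<close>, turns the number of orbits
  fixed by \<open>\<phi>\<close> into the number of pairs \<open>(\<tau>, x)\<close> with \<open>\<tau> \<cdot> \<phi> x = x\<close>.  For \<open>x = (t, f)\<close>
  with \<open>\<phi>\<close> acting on \<open>f\<close> by a map \<open>h\<close>, this condition says that \<open>t\<close> is fixed and that
  \<open>f \<circ> \<tau> = h \<circ> f\<close>; such an \<open>f\<close> is determined by its value at one point of each cycle, and that value
  is any \<open>a\<close> with \<open>h\<^sup>k a = a\<close>, where \<open>k\<close> is the length of the cycle.  Hence every cycle of length \<open>k\<close>
  contributes the factor \<open>\<Sum> w(a)\<^sup>k\<close> over the fixed points \<open>a\<close> of \<open>h\<^sup>k\<close>.  For \<open>G\<close> applied to \<open>\<bbbP>\<^sub>x\<close> we have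
  \<open>h = id\<close> and this factor is \<open>p\<^sub>k\<close>; for \<open>F\<close> applied to \<open>G(\<bbbP>\<^sub>x, [n])\<close> the map \<open>h\<close> is induced by \<open>\<sigma>\<close>
  and the factor is \<open>\<psi>\<^sup>k \<chi>(\<sigma>)\<close>.  That \<open>m!/z\<^sub>\<nu>\<close> permutations have cycle type \<open>\<nu>\<close> follows by comparing the
  result for the species of sets with Newton's identity \<open>n h\<^sub>n = \<Sum> p\<^sub>k h\<^bsub>n-k\<^esub>\<close>, since the \<open>p\<^sub>\<nu>\<close> are
  linearly independent.\<close>

section \<open>Enumerators of sets with monomial weights\<close>

lemma coeff_zero [simp]: "mps_coeff 0 m = 0" by transfer simp
lemma coeff_one: "mps_coeff 1 m = (if m = {#} then 1 else 0)" by transfer simp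
lemma coeff_add [simp]: "mps_coeff (f + g) m = mps_coeff f m + mps_coeff g m" by transfer simp

lemma coeff_times:
  "mps_coeff (f * g) m = (\<Sum>(a, b) | a + b = m. mps_coeff f a * mps_coeff g b)"
  by transfer simp

lemma coeff_sum [simp]: "mps_coeff (\<Sum>a\<in>A. f a) m = (\<Sum>a\<in>A. mps_coeff (f a) m)"
  by (induction A rule: infinite_finite_induct) auto

lemma coeff_const: "mps_coeff (mps_const c) m = (if m = {#} then c else 0)" by transfer simp

lemma coeff_const_times [simp]: "mps_coeff (mps_const c * f :: 'v mps) m = c * mps_coeff f m"
proof -
  have "(\<Sum>(a, b) | a + b = m. mps_coeff (mps_const c) a * mps_coeff f b)
      = (\<Sum>(a, b)\<in>{({#}, m)}. mps_coeff (mps_const c :: 'v mps) a * mps_coeff f b)"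
    by (rule sum.mono_neutral_right)
      (auto intro: finite_mset_splits simp: coeff_const split: if_splits)
  then show ?thesis by (simp add: coeff_times coeff_const)
qed

lemma coeff_mps_sum:
  "mps_coeff (mps_sum A w) m = (\<Sum>a | a \<in> A \<and> mps_coeff (w a) m \<noteq> 0. mps_coeff (w a) m)"
  by transfer simp

lemma coeff_mps_sum_finite:
  assumes "finite B" "B \<subseteq> A" "\<And>a. a \<in> A - B \<Longrightarrow> mps_coeff (w a) m = 0"
  shows "mps_coeff (mps_sum A w) m = (\<Sum>a\<in>B. mps_coeff (w a) m)"
  unfolding coeff_mps_sum by (rule sum.mono_neutral_left) (use assms in auto)

lemma mps_sum_reindex_bij_betw:
  assumes "bij_betw h A B" and "\<And>a. a \<in> A \<Longrightarrow> w' (h a) = w a"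
  shows "mps_sum A w = mps_sum B w'"
proof (rule mps_eqI)
  fix m
  have "bij_betw h {a \<in> A. mps_coeff (w a) m \<noteq> 0} {b \<in> B. mps_coeff (w' b) m \<noteq> 0}"
    using assms by (auto simp: bij_betw_def inj_on_def)
  then have "(\<Sum>a | a \<in> A \<and> mps_coeff (w a) m \<noteq> 0. mps_coeff (w' (h a)) m)
      = (\<Sum>b | b \<in> B \<and> mps_coeff (w' b) m \<noteq> 0. mps_coeff (w' b) m)"
    by (rule sum.reindex_bij_betw)
  then show "mps_coeff (mps_sum A w) m = mps_coeff (mps_sum B w') m"
    unfolding coeff_mps_sum using assms(2) by simp
qed

section \<open>Monomials as power series\<close>

lift_definition mps_monom :: "'v multiset \<Rightarrow> 'v mps" is "\<lambda>m m'. if m' = m then 1 else 0" .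

lemma coeff_monom: "mps_coeff (mps_monom a) m = (if m = a then 1 else 0)" by transfer simp

lemma coeff_monom_times: "mps_coeff (mps_monom a * f) m = (if a \<subseteq># m then mps_coeff f (m - a) else 0)"
proof -
  have "(\<Sum>(c, b) | c + b = m. mps_coeff (mps_monom a) c * mps_coeff f b)
      = (\<Sum>(c, b)\<in>(if a \<subseteq># m then {(a, m - a)} else {}). mps_coeff (mps_monom a) c * mps_coeff f b)"
    by (rule sum.mono_neutral_right)
      (auto intro: finite_mset_splits simp: coeff_monom split: if_splits)
  then show ?thesis by (simp add: coeff_times coeff_monom)
qed

lemma mps_monom_add: "mps_monom (a + b) = mps_monom a * mps_monom b"
  by (rule mps_eqI) (auto simp: coeff_monom_times coeff_monom mset_subset_eq_exists_conv)

lemma mps_monom_zero [simp]: "mps_monom {#} = 1"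
  by (rule mps_eqI) (auto simp: coeff_monom coeff_one)

lemma mps_monom_sum: "mps_monom (\<Sum>i\<in>I. f i) = (\<Prod>i\<in>I. mps_monom (f i))"
  by (induction I rule: infinite_finite_induct) (auto simp: mps_monom_add)

lemma mps_var_eq_monom: "mps_var i = mps_monom {#i#}"
  by transfer auto

lemma mps_monom_eq_iff [simp]: "mps_monom a = mps_monom b \<longleftrightarrow> a = b"
  by (metis coeff_monom zero_neq_one)

section \<open>Generating series of sets with a degree function\<close>

definition finite_fibres :: "'a set \<Rightarrow> ('a \<Rightarrow> 'b) \<Rightarrow> bool" where
  "finite_fibres E wt \<longleftrightarrow> (\<forall>m. finite {e \<in> E. wt e = m})"

text \<open>Weights that are monomials are stored by their exponents \<open>wt\<close>, so that an
  identity of series becomes one of cardinalities. \<open>finite_fibres E wt\<close> says exactly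
  that the monomials \<open>mps_monom (wt e)\<close> are summable over \<open>E\<close>.\<close>

definition enumerator :: "'a set \<Rightarrow> ('a \<Rightarrow> 'v multiset) \<Rightarrow> 'v mps" where
  "enumerator E wt = mps_sum E (\<lambda>e. mps_monom (wt e))"

lemma coeff_enumerator: "mps_coeff (enumerator E wt) m = of_nat (card {e \<in> E. wt e = m})"
proof -
  have "{e. e \<in> E \<and> mps_coeff (mps_monom (wt e)) m \<noteq> 0} = {e \<in> E. wt e = m}"
    by (auto simp: coeff_monom)
  then show ?thesis unfolding enumerator_def coeff_mps_sum by (simp add: coeff_monom)
qed

lemma finite_fibres_subset:
  assumes "finite_fibres E wt" "E' \<subseteq> E"
  shows "finite_fibres E' wt"
  unfolding finite_fibres_def
proof
  fix m
  have "{e \<in> E'. wt e = m} \<subseteq> {e \<in> E. wt e = m}" using assms(2) by blast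
  then show "finite {e \<in> E'. wt e = m}"
    using assms(1) unfolding finite_fibres_def by (blast intro: finite_subset)
qed

lemma finite_fibres_finite: "finite E \<Longrightarrow> finite_fibres E wt"
  by (auto simp: finite_fibres_def)

lemma enumerator_reindex:
  assumes "bij_betw h A B" and "\<And>a. a \<in> A \<Longrightarrow> wt' (h a) = wt a"
  shows "enumerator A wt = enumerator B wt'"
  unfolding enumerator_def by (rule mps_sum_reindex_bij_betw[OF assms(1)]) (simp add: assms(2))

lemma finite_fibres_reindex:
  assumes "bij_betw h A B" and "\<And>a. a \<in> A \<Longrightarrow> wt' (h a) = wt a" and "finite_fibres A wt"
  shows "finite_fibres B wt'"
  unfolding finite_fibres_def
proof
  fix m
  have "{b \<in> B. wt' b = m} = h ` {a \<in> A. wt a = m}"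
    using assms by (auto simp: bij_betw_def)
  then show "finite {b \<in> B. wt' b = m}" using assms(3) by (simp add: finite_fibres_def)
qed

text \<open>The index set of splittings is that of the Cauchy product in \<open>coeff_times\<close>,
  so counting this union gives the coefficient of a product of series.\<close>

lemma fibre_Times:
  "{e \<in> A \<times> B. wt (fst e) + wt' (snd e) = m} =
     (\<Union>p\<in>{(a, b). a + b = m}. {a \<in> A. wt a = fst p} \<times> {b \<in> B. wt' b = snd p})"
  by auto

lemma finite_fibres_Times:
  assumes "finite_fibres A wt" "finite_fibres B wt'"
  shows "finite_fibres (A \<times> B) (\<lambda>e. wt (fst e) + wt' (snd e) :: 'v multiset)"
  using assms unfolding finite_fibres_def fibre_Times
  by (auto intro!: finite_UN_I finite_mset_splits)

lemma enumerator_Times: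
  assumes "finite_fibres A wt" "finite_fibres B wt'"
  shows "enumerator (A \<times> B) (\<lambda>e. wt (fst e) + wt' (snd e)) = enumerator A wt * enumerator B wt'"
proof (rule mps_eqI)
  fix m
  let ?F = "\<lambda>p. {a \<in> A. wt a = fst p} \<times> {b \<in> B. wt' b = snd p}"
  have "card (\<Union>p\<in>{(a, b). a + b = m}. ?F p) = (\<Sum>p | p \<in> {(a, b). a + b = m}. card (?F p))"
    using assms by (subst card_UN_disjoint) (auto simp: finite_fibres_def finite_mset_splits)
  then show "mps_coeff (enumerator (A \<times> B) (\<lambda>e. wt (fst e) + wt' (snd e))) m
      = mps_coeff (enumerator A wt * enumerator B wt') m"
    unfolding coeff_times coeff_enumerator fibre_Times
    by (simp add: card_cartesian_product case_prod_unfold)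
qed

text \<open>Finiteness of the fibres is carried through the induction because the product rule for
  the next coordinate needs it for the functions on the smaller index set.\<close>

lemma enumerator_PiE_aux:
  assumes "finite I" and "\<And>i. i \<in> I \<Longrightarrow> finite_fibres (E i) (wt i)"
  shows "enumerator (PiE I E) (\<lambda>f. \<Sum>i\<in>I. wt i (f i)) = (\<Prod>i\<in>I. enumerator (E i) (wt i)) \<and>
    finite_fibres (PiE I E) (\<lambda>f. \<Sum>i\<in>I. wt i (f i) :: 'v multiset)"
  using assms
proof (induction I)
  case empty
  have "enumerator {\<lambda>x. undefined} (\<lambda>f. {#}) = 1"
    by (rule mps_eqI) (simp add: coeff_enumerator coeff_one)
  then show ?case by (auto simp: finite_fibres_finite)
next
  case (insert j I)
  \<comment> \<open>A function on \<open>insert j I\<close> amounts to its value \<open>y\<close> at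
    \<open>j\<close> and a function \<open>g\<close> on \<open>I\<close>.\<close>
  let ?h = "\<lambda>(y, g). g(j := y)"
  have bij: "bij_betw ?h (E j \<times> PiE I E) (PiE (insert j I) E)"
    unfolding bij_betw_def PiE_insert_eq
    using inj_combinator[OF insert.hyps(2), of E] by auto
  have wt: "(\<Sum>i\<in>insert j I. wt i (?h e i)) = wt j (fst e) + (\<Sum>i\<in>I. wt i (snd e i))" for e
    using insert.hyps by (auto simp: case_prod_unfold intro!: sum.cong)
  have ff: "finite_fibres (E j) (wt j)" "finite_fibres (PiE I E) (\<lambda>f. \<Sum>i\<in>I. wt i (f i))"
    using insert by auto
  show ?case
    using enumerator_reindex[where wt' = "\<lambda>f. \<Sum>i\<in>insert j I. wt i (f i)", OF bij wt]
      enumerator_Times[OF ff] insert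
      finite_fibres_reindex[where wt' = "\<lambda>f. \<Sum>i\<in>insert j I. wt i (f i)",
        OF bij wt finite_fibres_Times[OF ff]] by simp
qed

lemmas enumerator_PiE = enumerator_PiE_aux[THEN conjunct1]
lemmas finite_fibres_PiE = enumerator_PiE_aux[THEN conjunct2]

section \<open>Replacing every variable by its k-th power\<close>

lemma repeat_mset_cancel: "k > 0 \<Longrightarrow> repeat_mset k a = repeat_mset k b \<longleftrightarrow> a = b"
  by (auto simp: multiset_eq_iff)

text \<open>The substitution turns a monomial with exponent \<open>m\<close> into one with exponent
  \<open>repeat_mset k m\<close>. For positive \<open>k\<close> this is injective on exponents, so
  the defining sum of \<open>pth_plethysm\<close> has at most one term.\<close>

lemma pth_plethysm_enumerator:
  assumes "k > 0"
  shows "pth_plethysm k (enumerator E wt) = enumerator E (\<lambda>e. repeat_mset k (wt e))"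
proof (rule mps_eqI)
  fix m
  have *: "mps_coeff (pth_plethysm k f) m = (\<Sum>m' | repeat_mset k m' = m. mps_coeff f m')"
    for f :: "'v mps" and m
    by transfer simp
  show "mps_coeff (pth_plethysm k (enumerator E wt)) m = mps_coeff (enumerator E (\<lambda>e. repeat_mset k (wt e))) m"
  proof (cases "\<exists>m'. repeat_mset k m' = m")
    case True
    then obtain m' where m': "m = repeat_mset k m'" by auto
    then have "{m'. repeat_mset k m' = m} = {m'}"
      using repeat_mset_cancel[OF assms] by auto
    then show ?thesis
      unfolding * coeff_enumerator m' by (simp add: repeat_mset_cancel[OF assms] del: repeat_mset_cancel1)
  next
    case False
    then have "{e \<in> E. repeat_mset k (wt e) = m} = {}" by auto
    with False show ?thesis unfolding * coeff_enumerator by (simp only: card.empty) simp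
  qed
qed

section \<open>Cycles of permutations\<close>

lemma funpow_fixed_mult: "(f ^^ p) x = x \<Longrightarrow> (f ^^ (p * q)) x = x"
  by (induction q) (auto simp: funpow_add)

text \<open>The inductive set \<open>orbit \<tau> i\<close> starts with \<open>\<tau> i\<close>; it
  comes back to \<open>i\<close> because \<tau> moves only finitely many points.\<close>

lemma orbit_refl: "\<tau> permutes {1..m :: nat} \<Longrightarrow> i \<in> orbit \<tau> i"
  by (rule permutation_self_in_orbit[OF permutes_imp_permutation[OF finite_atLeastAtMost]])

lemma orbit_eq: "\<tau> permutes {1..m :: nat} \<Longrightarrow> j \<in> orbit \<tau> i \<Longrightarrow> orbit \<tau> j = orbit \<tau> i"
  using cyclic_on_orbit orbit_cyclic_eq3 finite_atLeastAtMost by metis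

lemma orbit_funpow: "\<tau> permutes {1..m :: nat} \<Longrightarrow> orbit \<tau> i = {(\<tau> ^^ j) i | j. True}"
  by (rule orbit_altdef_permutation[OF permutes_imp_permutation[OF finite_atLeastAtMost]])

lemma finite_orbit_perm: "\<tau> permutes {1..m :: nat} \<Longrightarrow> finite (orbit \<tau> i)"
  by (rule finite_orbit[OF orbit_refl])

text \<open>The first return time \<open>p\<close> of \<open>i\<close> equals the orbit length,
  since the first \<open>p\<close> iterates list the orbit without repetition. Any other return time
  is a multiple of \<open>p\<close>: its remainder modulo \<open>p\<close> would otherwise be a
  smaller positive return time.\<close>

lemma funpow_card_orbit:
  assumes "\<tau> permutes {1..m :: nat}"
  shows "(\<tau> ^^ card (orbit \<tau> i)) i = i"
    and "(\<tau> ^^ d) i = i \<Longrightarrow> card (orbit \<tau> i) dvd d"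
proof -
  note i = orbit_refl[OF assms, of i]
  define p where "p = funpow_dist1 \<tau> i i"
  have p: "p > 0" "(\<tau> ^^ p) i = i"
    using funpow_dist1_prop[OF i] by (simp_all add: p_def del: funpow.simps)
  have "card (orbit \<tau> i) = card {0..<p}"
    unfolding p_def orbit_conv_funpow_dist1[OF i] by (rule card_image inj_on_funpow_dist1 i)+
  then have card: "card (orbit \<tau> i) = p" by simp
  show "(\<tau> ^^ card (orbit \<tau> i)) i = i" using p card by simp
  show "card (orbit \<tau> i) dvd d" if d: "(\<tau> ^^ d) i = i"
  proof (rule ccontr)
    assume "\<not> card (orbit \<tau> i) dvd d"
    then have "d mod p \<noteq> 0" "d mod p < p" using p card by (auto simp: mod_eq_0_iff_dvd)
    moreover have "(\<tau> ^^ (d mod p)) i = i"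
    proof -
      have "(\<tau> ^^ (d mod p + p * (d div p))) i = i" using d by simp
      then show ?thesis unfolding funpow_add using funpow_fixed_mult[OF p(2)] by simp
    qed
    ultimately show False using funpow_dist1_least[of "d mod p" \<tau> i i] by (simp add: p_def)
  qed
qed

text \<open>On a cycle \<open>c\<close> put \<open>f ((\<tau> ^^ j) (r c)) = (h ^^ j) (b c)\<close>;
  the periodicity of \<open>b c\<close> makes this independent of \<open>j\<close>. The last
  conclusion later ensures that \<open>f\<close> stays in a set that is closed under
  \<open>h\<close> and contains the values of \<open>b\<close>.\<close>

lemma equivariant_extension:
  assumes \<tau>: "\<tau> permutes {1..m :: nat}"
    and r: "\<And>c. c \<in> orbit \<tau> ` {1..m} \<Longrightarrow> r c \<in> c"
    and per: "\<And>c. c \<in> orbit \<tau> ` {1..m} \<Longrightarrow> (h ^^ card c) (b c) = b c"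
  obtains f where "\<And>i. i \<in> {1..m} \<Longrightarrow> f (\<tau> i) = h (f i)"
    and "\<And>c. c \<in> orbit \<tau> ` {1..m} \<Longrightarrow> f (r c) = b c"
    and "\<And>i. i \<in> {1..m} \<Longrightarrow> \<exists>j. f i = (h ^^ j) (b (orbit \<tau> i))"
proof
  \<comment> \<open>\<open>J i\<close> is some number of steps that lead from the representative of
    the cycle to \<open>i\<close>.\<close>
  define J where "J = (\<lambda>i. SOME j. i = (\<tau> ^^ j) (r (orbit \<tau> i)))"
  define f where "f = (\<lambda>i. (h ^^ J i) (b (orbit \<tau> i)))"
  have orb: "orbit \<tau> (r (orbit \<tau> i)) = orbit \<tau> i" if "i \<in> {1..m}" for i
    using orbit_eq[OF \<tau>] r that by blast
  have J: "i = (\<tau> ^^ J i) (r (orbit \<tau> i))" if "i \<in> {1..m}" for i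
    unfolding J_def
  proof (rule someI_ex)
    have "i \<in> orbit \<tau> (r (orbit \<tau> i))" using orb[OF that] orbit_refl[OF \<tau>] by simp
    then show "\<exists>j. i = (\<tau> ^^ j) (r (orbit \<tau> i))" unfolding orbit_funpow[OF \<tau>] by blast
  qed
  \<comment> \<open>Two exponents that reach the same point differ by a multiple of the cycle
    length, and that many applications of \<open>h\<close> fix the prescribed value.\<close>
  have le: "(h ^^ j) (b (orbit \<tau> i)) = (h ^^ j') (b (orbit \<tau> i))"
    if i: "i \<in> {1..m}" and "j \<le> j'" and eq: "(\<tau> ^^ j) (r (orbit \<tau> i)) = (\<tau> ^^ j') (r (orbit \<tau> i))"
    for i j j'
  proof -
    let ?c = "orbit \<tau> i"
    obtain d where d: "j' = j + d" using \<open>j \<le> j'\<close> by (auto simp: le_iff_add)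
    have "inj (\<tau> ^^ j)" using \<tau> by (simp add: permutes_inj)
    moreover have "(\<tau> ^^ j) ((\<tau> ^^ d) (r ?c)) = (\<tau> ^^ j) (r ?c)"
      using eq unfolding d funpow_add comp_def by (rule sym)
    ultimately have "(\<tau> ^^ d) (r ?c) = r ?c" by (rule injD)
    then have "card ?c dvd d" using funpow_card_orbit(2)[OF \<tau>] orb[OF i] by metis
    then obtain q where "d = card ?c * q" by (auto simp: dvd_def)
    then have "(h ^^ d) (b ?c) = b ?c" using funpow_fixed_mult[OF per[OF imageI[OF i]]] by simp
    then show ?thesis by (simp add: d funpow_add)
  qed
  have key: "f i = (h ^^ j) (b (orbit \<tau> i))"
    if i: "i \<in> {1..m}" and j: "i = (\<tau> ^^ j) (r (orbit \<tau> i))" for i j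
    using le[OF i, of j "J i"] le[OF i, of "J i" j] j J[OF i] nat_le_linear[of j "J i"]
    unfolding f_def by metis
  show "f (\<tau> i) = h (f i)" if i: "i \<in> {1..m}" for i
  proof -
    have "orbit \<tau> (\<tau> i) = orbit \<tau> i" using orbit_eq[OF \<tau>] orbit.base by metis
    moreover have "\<tau> i \<in> {1..m}" using i \<tau> by (simp only: permutes_in_image)
    ultimately have "f (\<tau> i) = (h ^^ Suc (J i)) (b (orbit \<tau> i))"
      using key[of "\<tau> i" "Suc (J i)"] J[OF i] by simp
    then show ?thesis by (simp add: f_def)
  qed
  show "f (r c) = b c" if c: "c \<in> orbit \<tau> ` {1..m}" for c
  proof -
    from c obtain i where i: "i \<in> {1..m}" "c = orbit \<tau> i" by auto
    then have "r c \<in> {1..m}" using r[OF c] permutes_orbit_subset[OF \<tau>] by blast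
    with i orb show ?thesis using key[of "r c" 0] by simp
  qed
  show "\<exists>j. f i = (h ^^ j) (b (orbit \<tau> i))" if "i \<in> {1..m}" for i
    unfolding f_def by blast
qed

lemma equivariant_funpow:
  assumes "\<tau> permutes {1..m :: nat}" "\<And>i. i \<in> {1..m} \<Longrightarrow> f (\<tau> i) = h (f i)" "i \<in> {1..m}"
  shows "f ((\<tau> ^^ j) i) = (h ^^ j) (f i)"
proof (induction j)
  case (Suc j)
  have "(\<tau> ^^ j) i \<in> {1..m}" using assms permutes_in_funpow_image by metis
  then show ?case using assms(2) Suc by simp
qed auto

section \<open>Cycle types and conjugacy\<close>

lemma prod_cycle_type:
  "(\<Prod>k\<in>#cycle_type m \<tau>. v k) = (\<Prod>c\<in>orbit \<tau> ` {1..m}. v (card c))"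
  by (simp add: cycle_type_def prod_unfold_prod_mset image_mset.compositionality comp_def)

lemma Union_orbits: "\<tau> permutes {1..m :: nat} \<Longrightarrow> \<Union> (orbit \<tau> ` {1..m}) = {1..m}"
  using permutes_orbit_subset orbit_refl by fast

lemma sum_orbits:
  assumes "\<tau> permutes {1..m :: nat}"
  shows "(\<Sum>i\<in>{1..m}. f i) = (\<Sum>c\<in>orbit \<tau> ` {1..m}. \<Sum>i\<in>c. f i)"
proof -
  have "(\<Sum>i\<in>\<Union> (orbit \<tau> ` {1..m}). f i) = (\<Sum>c\<in>orbit \<tau> ` {1..m}. \<Sum>i\<in>c. f i)"
  proof (rule sum.Union_disjoint[unfolded comp_def])
    show "\<forall>c\<in>orbit \<tau> ` {1..m}. \<forall>d\<in>orbit \<tau> ` {1..m}. c \<noteq> d \<longrightarrow> c \<inter> d = {}"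
      using orbit_eq[OF assms] by blast
  qed (use finite_orbit_perm[OF assms] in blast)
  then show ?thesis by (simp only: Union_orbits[OF assms])
qed

lemma cycle_type_partition:
  assumes "\<tau> permutes {1..m :: nat}"
  shows "cycle_type m \<tau> \<in> partitions" "\<Sum>\<^sub># (cycle_type m \<tau>) = m"
proof -
  show "cycle_type m \<tau> \<in> partitions"
    using finite_orbit_perm[OF assms] orbit_nonempty
    by (fastforce simp: partitions_def cycle_type_def card_eq_0_iff)
  have "\<Sum>\<^sub># (cycle_type m \<tau>) = (\<Sum>c\<in>orbit \<tau> ` {1..m}. \<Sum>i\<in>c. 1)"
    by (simp add: cycle_type_def sum_unfold_sum_mset)
  also have "\<dots> = m" using sum_orbits[OF assms, of "\<lambda>_. 1 :: nat"] by simp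
  finally show "\<Sum>\<^sub># (cycle_type m \<tau>) = m" .
qed

text \<open>Greedy matching: \<open>x\<close> is paired with some \<open>y\<close> in
  \<open>B\<close> of the same value, both are removed, and the two image multisets lose the same
  element.\<close>

lemma image_mset_eq_imp_bij_betw:
  assumes "finite A" "finite B" "image_mset f (mset_set A) = image_mset g (mset_set B)"
  obtains h where "bij_betw h A B" "\<And>a. a \<in> A \<Longrightarrow> g (h a) = f a"
proof -
  have "\<exists>h. bij_betw h A B \<and> (\<forall>a\<in>A. g (h a) = f a)"
    using assms
  proof (induction A arbitrary: B)
    case empty
    then have "B = {}" by (simp add: mset_set_empty_iff)
    then show ?case by (simp add: bij_betw_def)
  next
    case (insert x A)
    from insert.hyps have "f x \<in># image_mset f (mset_set (insert x A))" by simp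
    then have "f x \<in># image_mset g (mset_set B)" by (simp only: insert.prems(2))
    then obtain y where y: "y \<in> B" "g y = f x" using insert.prems(1) by auto
    have "image_mset g (mset_set B) = add_mset (g y) (image_mset g (mset_set (B - {y})))"
      using y insert.prems(1) by (simp add: mset_set.remove)
    with insert.hyps y insert.prems have "image_mset f (mset_set A) = image_mset g (mset_set (B - {y}))" by simp
    with insert obtain h where h: "bij_betw h A (B - {y})" "\<forall>a\<in>A. g (h a) = f a" by blast
    have "bij_betw (h(x := y)) A (B - {y})"
      using h(1) insert.hyps by (auto intro: bij_betw_cong[THEN iffD1, rotated])
    then have "bij_betw (h(x := y)) (insert x A) (insert y (B - {y}))"
      using notIn_Un_bij_betw[of x A "h(x := y)" "B - {y}"] insert.hyps by simp
    then have "bij_betw (h(x := y)) (insert x A) B" using insert_Diff[OF y(1)] by simp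
    moreover have "\<forall>a\<in>insert x A. g ((h(x := y)) a) = f a" using h(2) y(2) insert.hyps by auto
    ultimately show ?case by blast
  qed
  then show ?thesis using that by blast
qed

text \<open>Equal cycle types give a length-preserving bijection \<open>h\<close> between the
  cycles. Sending the representative of \<open>c\<close> to that of \<open>h c\<close> extends
  equivariantly along the cycles, and the extension is the conjugating permutation.\<close>

lemma cycle_type_eq_imp_conj:
  assumes \<sigma>: "\<sigma> permutes {1..m}" and \<tau>: "\<tau> permutes {1..m :: nat}"
    and eq: "cycle_type m \<sigma> = cycle_type m \<tau>"
  obtains \<pi> where "\<pi> permutes {1..m}" "\<pi> \<circ> \<sigma> = \<tau> \<circ> \<pi>"
proof -
  define r where "r = (\<lambda>c :: nat set. SOME i. i \<in> c)"
  have r: "r c \<in> c" if "c \<in> orbit \<rho> ` {1..m}" for c \<rho>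
    unfolding r_def by (rule someI_ex) (use that orbit_nonempty in fastforce)
  obtain h where h: "bij_betw h (orbit \<sigma> ` {1..m}) (orbit \<tau> ` {1..m})"
    "\<And>c. c \<in> orbit \<sigma> ` {1..m} \<Longrightarrow> card (h c) = card c"
    using image_mset_eq_imp_bij_betw[of "orbit \<sigma> ` {1..m}" "orbit \<tau> ` {1..m}" card card] eq
    unfolding cycle_type_def by (metis finite_atLeastAtMost finite_imageI)
  have hr: "h c \<in> orbit \<tau> ` {1..m}" "r (h c) \<in> h c" "orbit \<tau> (r (h c)) = h c"
    if "c \<in> orbit \<sigma> ` {1..m}" for c
  proof -
    show *: "h c \<in> orbit \<tau> ` {1..m}" using h(1) that by (auto simp: bij_betw_def)
    show **: "r (h c) \<in> h c" by (rule r[OF *])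
    show "orbit \<tau> (r (h c)) = h c" using * ** orbit_eq[OF \<tau>] by auto
  qed
  \<comment> \<open>The map on values is \<tau> itself; the period condition holds as
    \<open>r (h c)\<close> lies on a cycle of length \<open>card c\<close>.\<close>
  obtain f where f: "\<And>i. i \<in> {1..m} \<Longrightarrow> f (\<sigma> i) = \<tau> (f i)"
    "\<And>c. c \<in> orbit \<sigma> ` {1..m} \<Longrightarrow> f (r c) = r (h c)"
  proof (rule equivariant_extension[OF \<sigma>, of r \<tau> "\<lambda>c. r (h c)"])
    show "(\<tau> ^^ card c) (r (h c)) = r (h c)" if "c \<in> orbit \<sigma> ` {1..m}" for c
      using funpow_card_orbit(1)[OF \<tau>, of "r (h c)"] hr[OF that] h(2)[OF that] by simp
  qed (use r in auto)
  \<comment> \<open>On a finite set surjectivity gives bijectivity.\<close>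
  have "{1..m} \<subseteq> f ` {1..m}"
  proof
    fix i assume i: "i \<in> {1..m}"
    then have "orbit \<tau> i \<in> h ` (orbit \<sigma> ` {1..m})"
      unfolding bij_betw_imp_surj_on[OF h(1)] by (rule imageI)
    then obtain c where c: "c \<in> orbit \<sigma> ` {1..m}" "h c = orbit \<tau> i" by (metis imageE)
    have "i \<in> orbit \<tau> (r (h c))" using hr[OF c(1)] c(2) orbit_refl[OF \<tau>] by simp
    then obtain j where j: "i = (\<tau> ^^ j) (r (h c))" unfolding orbit_funpow[OF \<tau>] by blast
    have rc: "r c \<in> {1..m}" using r[OF c(1)] Union_orbits[OF \<sigma>] c(1) by blast
    have "i = f ((\<sigma> ^^ j) (r c))"
      using equivariant_funpow[of \<sigma> m f \<tau>, OF \<sigma> f(1) rc] f(2)[OF c(1)] j by simp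
    moreover have "(\<sigma> ^^ j) (r c) \<in> {1..m}" using rc \<sigma> permutes_in_funpow_image by metis
    ultimately show "i \<in> f ` {1..m}" by blast
  qed
  then have img: "f ` {1..m} = {1..m}"
    by (metis card_image_le card_seteq finite_atLeastAtMost finite_imageI)
  then have bij: "bij_betw f {1..m} {1..m}"
    by (simp add: bij_betw_def eq_card_imp_inj_on)
  \<comment> \<open>\<open>permutes\<close> demands the identity outside \<open>{1..m}\<close>,
    where nothing is known about \<open>f\<close>.\<close>
  show ?thesis
  proof (rule that[of "restrict_id f {1..m}"])
    show "restrict_id f {1..m} permutes {1..m}" by (rule permutes_restrict_id[OF bij])
    show "restrict_id f {1..m} \<circ> \<sigma> = \<tau> \<circ> restrict_id f {1..m}"
    proof
      fix i
      show "(restrict_id f {1..m} \<circ> \<sigma>) i = (\<tau> \<circ> restrict_id f {1..m}) i"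
      proof (cases "i \<in> {1..m}")
        case True
        then have "\<sigma> i \<in> {1..m}" using \<sigma> by (simp only: permutes_in_image)
        with True f(1) show ?thesis by (simp add: restrict_id_def del: atLeastAtMost_iff)
      next
        case False
        then show ?thesis using permutes_not_in[OF \<sigma>] permutes_not_in[OF \<tau>]
          by (simp add: restrict_id_def del: atLeastAtMost_iff)
      qed
    qed
  qed
qed

text \<open>\<open>\<pi>\<close> maps the cycles of \<sigma> bijectively onto those of the conjugate
  and preserves their lengths.\<close>

lemma cycle_type_conj:
  assumes \<sigma>: "\<sigma> permutes {1..m}" and \<pi>: "\<pi> permutes {1..m}"
  shows "cycle_type m (\<pi> \<circ> \<sigma> \<circ> inv \<pi>) = cycle_type m \<sigma>"
proof -
  have orb: "orbit (\<pi> \<circ> \<sigma> \<circ> inv \<pi>) (\<pi> i) = \<pi> ` orbit \<sigma> i" for i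
    using orbit_inverse[OF orbit_refl[OF \<sigma>, of i], of "\<pi> \<circ> \<sigma> \<circ> inv \<pi>" \<pi>]
    by (simp add: permutes_inverses[OF \<pi>])
  have "orbit (\<pi> \<circ> \<sigma> \<circ> inv \<pi>) ` {1..m} = orbit (\<pi> \<circ> \<sigma> \<circ> inv \<pi>) ` (\<pi> ` {1..m})"
    by (simp only: permutes_image[OF \<pi>])
  also have "\<dots> = image \<pi> ` (orbit \<sigma> ` {1..m})" by (simp only: image_image orb)
  finally have "mset_set (orbit (\<pi> \<circ> \<sigma> \<circ> inv \<pi>) ` {1..m})
      = image_mset (image \<pi>) (mset_set (orbit \<sigma> ` {1..m}))"
    using permutes_inj[OF \<pi>] by (subst image_mset_mset_set) (auto simp: inj_on_def inj_image_eq_iff)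
  then show ?thesis
    unfolding cycle_type_def
    by (simp add: image_mset.compositionality comp_def card_image permutes_inj_on[OF \<pi>])
qed

section \<open>Products of power sums\<close>

lemma power_sum_eq_enumerator: "power_sum k = enumerator UNIV (\<lambda>i. replicate_mset k i)"
proof -
  have "mps_var i ^ k = mps_monom (replicate_mset k i)" for i :: 'a
    by (induction k) (simp_all add: mps_var_eq_monom flip: mps_monom_add)
  then show ?thesis by (simp add: power_sum_def enumerator_def)
qed

text \<open>\<open>power_sum k\<close> is the sum of the k-th powers of the variables, so a
  splitting of \<open>m\<close> contributes only if its first part consists of \<open>k\<close>
  copies of one variable.\<close>

lemma coeff_power_sum_times:
  assumes "k > 0"
  shows "mps_coeff (power_sum k * g) m =
    (\<Sum>i | i \<in># m \<and> k \<le> count m i. mps_coeff g (m - replicate_mset k i))"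
proof -
  let ?I = "{i. i \<in># m \<and> k \<le> count m i}" and ?h = "\<lambda>i. (replicate_mset k i, m - replicate_mset k i)"
  have inj: "replicate_mset k i = replicate_mset k j \<longleftrightarrow> i = j" for i j :: 'a
    using assms by (auto simp: replicate_mset_eq_iff)
  then have fib: "mps_coeff (power_sum k) (replicate_mset k i) = 1" for i :: 'a
    by (simp add: power_sum_eq_enumerator coeff_enumerator)
  have "(\<Sum>(a, b) | a + b = m. mps_coeff (power_sum k) a * mps_coeff g b)
      = (\<Sum>(a, b)\<in>?h ` ?I. mps_coeff (power_sum k) a * mps_coeff g b)"
  proof (rule sum.mono_neutral_right[OF finite_mset_splits])
    show "?h ` ?I \<subseteq> {(a, b). a + b = m}"
      by (auto simp: count_le_replicate_mset_subset_eq)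
    show "\<forall>p\<in>{(a, b). a + b = m} - ?h ` ?I.
        (case p of (a, b) \<Rightarrow> mps_coeff (power_sum k) a * mps_coeff g b) = 0"
    proof
      fix p assume "p \<in> {(a, b). a + b = m} - ?h ` ?I"
      then obtain a b where ab: "p = (a, b)" "m = a + b" "(a, b) \<notin> ?h ` ?I" by blast
      have "\<nexists>i. a = replicate_mset k i"
      proof
        assume "\<exists>i. a = replicate_mset k i"
        then obtain i where "a = replicate_mset k i" by blast
        then have "(a, b) = ?h i" "i \<in> ?I" using assms ab by auto
        with ab(3) show False by blast
      qed
      then have "{i. replicate_mset k i = a} = {}" by auto
      then show "(case p of (a, b) \<Rightarrow> mps_coeff (power_sum k) a * mps_coeff g b) = 0"
        by (simp add: ab(1) power_sum_eq_enumerator coeff_enumerator)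
    qed
  qed
  also have "\<dots> = (\<Sum>i\<in>?I. mps_coeff g (m - replicate_mset k i))"
    using inj fib by (subst sum.reindex) (auto simp: inj_on_def)
  finally show ?thesis by (simp add: coeff_times)
qed

lemma power_sum_part_empty [simp]: "power_sum_part {#} = 1"
  by (simp add: power_sum_part_def)

lemma power_sum_part_add: "power_sum_part (add_mset k \<nu>) = power_sum k * power_sum_part \<nu>"
  by (simp add: power_sum_part_def)

lemma partitions_add: "add_mset k \<nu> \<in> partitions \<longleftrightarrow> k > 0 \<and> \<nu> \<in> partitions"
  by (cases k) (auto simp: partitions_def)

lemma partitions_pos: "\<nu> \<in> partitions \<Longrightarrow> k \<in># \<nu> \<Longrightarrow> k > 0"
  by (cases k) (auto simp: partitions_def)

lemma partitions_remove: "\<nu> \<in> partitions \<Longrightarrow> \<nu> - {#k#} \<in> partitions"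
  by (auto simp: partitions_def dest: in_diffD)

lemma partitions_empty [simp]: "{#} \<in> partitions"
  by (simp add: partitions_def)

text \<open>Nonnegative coefficients exclude cancellation when a monomial of prescribed type is
  produced below.\<close>

lemma coeff_power_sum_part_nonneg: "\<nu> \<in> partitions \<Longrightarrow> mps_coeff (power_sum_part \<nu>) m \<ge> 0"
proof (induction \<nu> arbitrary: m)
  case (add k \<nu>)
  then show ?case
    by (auto simp: power_sum_part_add partitions_add coeff_power_sum_times intro!: sum_nonneg)
qed (simp add: coeff_one)

text \<open>Homogeneity: at a monomial of degree \<open>n\<close> only partitions of
  \<open>n\<close> matter, so sums over all partitions become finite in each degree.\<close>

lemma coeff_power_sum_part_size:
  "\<nu> \<in> partitions \<Longrightarrow> mps_coeff (power_sum_part \<nu>) m \<noteq> 0 \<Longrightarrow> size m = \<Sum>\<^sub># \<nu>"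
proof (induction \<nu> arbitrary: m)
  case (add k \<nu>)
  then have k: "k > 0" "\<nu> \<in> partitions" by (auto simp: partitions_add)
  with add.prems obtain i where i: "k \<le> count m i"
    "mps_coeff (power_sum_part \<nu>) (m - replicate_mset k i) \<noteq> 0"
    by (auto simp: power_sum_part_add coeff_power_sum_times elim: sum.not_neutral_contains_not_neutral)
  have sub: "replicate_mset k i \<subseteq># m" using i(1) by (simp add: count_le_replicate_mset_subset_eq)
  have "size m - k = \<Sum>\<^sub># \<nu>"
    using add.IH[OF k(2) i(2)] by (simp add: size_Diff_submset[OF sub])
  moreover have "k \<le> size m" using size_mset_mono[OF sub] by simp
  ultimately show ?case by simp
qed (simp add: coeff_one split: if_splits)

section \<open>Monomial types and linear independence\<close>

definition exponents :: "'v multiset \<Rightarrow> nat multiset" where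
  "exponents m = image_mset (count m) (mset_set (set_mset m))"

text \<open>\<open>exponents m\<close> is the partition whose monomial symmetric function contains
  the monomial \<open>m\<close>; a fresh variable to the power \<open>k\<close> appends a part
  \<open>k\<close>.\<close>

lemma exponents_add_replicate:
  assumes "k > 0" "i \<notin># m"
  shows "exponents (m + replicate_mset k i) = add_mset k (exponents m)"
proof -
  have "set_mset (m + replicate_mset k i) = insert i (set_mset m)" using assms by auto
  moreover have "count (m + replicate_mset k i) i = k" using assms by (simp add: count_eq_zero_iff)
  moreover have "image_mset (count (m + replicate_mset k i)) (mset_set (set_mset m))
      = image_mset (count m) (mset_set (set_mset m))"
    using assms(2) by (intro image_mset_cong) auto
  ultimately show ?thesis using assms(2) by (simp add: exponents_def)
qed

lemma size_exponents: "size (exponents m) = card (set_mset m)"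
  by (simp add: exponents_def)

text \<open>A product of \<open>r\<close> power sums contains only monomials in at most \<open>r\<close> variables; the products
  of power sums are therefore triangular with respect to the number of factors.\<close>

lemma coeff_power_sum_part_exponents:
  "\<nu> \<in> partitions \<Longrightarrow> mps_coeff (power_sum_part \<nu>) m \<noteq> 0 \<Longrightarrow>
    size (exponents m) < size \<nu> \<or> exponents m = \<nu>"
proof (induction \<nu> arbitrary: m)
  case empty
  then show ?case by (auto simp: coeff_one exponents_def split: if_splits)
next
  case (add k \<nu>)
  then have k: "k > 0" "\<nu> \<in> partitions" by (auto simp: partitions_add)
  with add.prems obtain i where i: "i \<in># m" "k \<le> count m i"
    "mps_coeff (power_sum_part \<nu>) (m - replicate_mset k i) \<noteq> 0"
    by (auto simp: power_sum_part_add coeff_power_sum_times elim: sum.not_neutral_contains_not_neutral)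
  define m' where "m' = m - replicate_mset k i"
  have m: "m = m' + replicate_mset k i"
    using i(2) by (simp add: m'_def count_le_replicate_mset_subset_eq)
  have IH: "size (exponents m') < size \<nu> \<or> exponents m' = \<nu>"
    using add.IH[OF k(2)] i(3) by (simp add: m'_def)
  show ?case
  proof (cases "i \<in># m'")
    \<comment> \<open>No new variable arises, so the number of variables is at most
      \<open>size \<nu>\<close>, less than the number of parts of
      \<open>add_mset k \<nu>\<close>.\<close>
    case True
    then have "set_mset m = set_mset m'" using m by (auto split: if_splits)
    then show ?thesis using IH by (auto simp: size_exponents)
  next
    case False
    then show ?thesis using IH exponents_add_replicate[OF k(1) False] m by auto
  qed
qed

text \<open>Multiplying a monomial of type \<nu> by the k-th power of a variable not in it gives
  type \<open>add_mset k \<nu>\<close>. Its coefficient is bounded below by a positive term, as all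
  terms are nonnegative; infinitely many variables provide the fresh one.\<close>

lemma ex_coeff_power_sum_part_pos:
  assumes "infinite (UNIV :: 'v set)"
  shows "\<nu> \<in> partitions \<Longrightarrow>
    \<exists>m :: 'v multiset. exponents m = \<nu> \<and> mps_coeff (power_sum_part \<nu>) m > 0"
proof (induction \<nu>)
  case empty
  then show ?case by (intro exI[of _ "{#}"]) (simp add: exponents_def coeff_one)
next
  case (add k \<nu>)
  then have k: "k > 0" "\<nu> \<in> partitions" by (auto simp: partitions_add)
  with add obtain m :: "'v multiset" where m: "exponents m = \<nu>" "mps_coeff (power_sum_part \<nu>) m > 0"
    by auto
  obtain i where i: "i \<notin># m" using ex_new_if_finite[OF assms finite_set_mset] by auto
  let ?m = "m + replicate_mset k i"
  have "mps_coeff (power_sum_part \<nu>) (?m - replicate_mset k i) \<le>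
      (\<Sum>j | j \<in># ?m \<and> k \<le> count ?m j. mps_coeff (power_sum_part \<nu>) (?m - replicate_mset k j))"
    using k by (intro member_le_sum coeff_power_sum_part_nonneg) auto
  with m k have "mps_coeff (power_sum_part (add_mset k \<nu>)) ?m > 0"
    by (simp add: power_sum_part_add coeff_power_sum_times)
  then show ?case using exponents_add_replicate[OF k(1) i] m(1) by blast
qed

text \<open>Among the partitions with nonzero coefficient one with the most parts, \<open>l\<close>,
  is tested at a monomial of type \<open>l\<close>: by triangularity every other term of the
  relation vanishes there.\<close>

theorem power_sum_part_independent:
  assumes "infinite (UNIV :: 'v set)" and K: "finite K" "K \<subseteq> partitions"
    and zero: "\<And>m :: 'v multiset. (\<Sum>\<nu>\<in>K. c \<nu> * mps_coeff (power_sum_part \<nu>) m) = 0"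
    and "\<nu> \<in> K"
  shows "c \<nu> = 0"
proof (rule ccontr)
  assume "c \<nu> \<noteq> 0"
  let ?K = "{\<nu> \<in> K. c \<nu> \<noteq> 0}"
  have "finite (size ` ?K)" "size ` ?K \<noteq> {}" using K \<open>\<nu> \<in> K\<close> \<open>c \<nu> \<noteq> 0\<close> by auto
  then have "Max (size ` ?K) \<in> size ` ?K" by (rule Max_in)
  then obtain l where l: "l \<in> ?K" "size l = Max (size ` ?K)" by force
  have max: "size \<nu> \<le> size l" if "\<nu> \<in> ?K" for \<nu>
    using Max_ge[of "size ` ?K" "size \<nu>"] that K l(2) by simp
  then obtain m :: "'v multiset" where m: "exponents m = l" "mps_coeff (power_sum_part l) m > 0"
    using ex_coeff_power_sum_part_pos[OF assms(1), of l] K l(1) by blast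
  have "c \<nu> * mps_coeff (power_sum_part \<nu>) m = 0" if "\<nu> \<in> K - {l}" for \<nu>
  proof (cases "c \<nu> = 0")
    case False
    then have "size \<nu> \<le> size (exponents m)" "\<nu> \<in> partitions" "exponents m \<noteq> \<nu>"
      using max[of \<nu>] that K m(1) by auto
    then have "mps_coeff (power_sum_part \<nu>) m = 0"
      using coeff_power_sum_part_exponents[of \<nu> m] by auto
    then show ?thesis by simp
  qed simp
  then have "(\<Sum>\<nu>\<in>K. c \<nu> * mps_coeff (power_sum_part \<nu>) m)
      = (\<Sum>\<nu>\<in>{l}. c \<nu> * mps_coeff (power_sum_part \<nu>) m)"
    using K l(1) by (intro sum.mono_neutral_right) auto
  with zero[of m] m l(1) show False by simp
qed

lemma infinite_UNIV_num: "infinite (UNIV :: num set)"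
proof
  assume "finite (UNIV :: num set)"
  then have "finite (range nat_of_num)" by simp
  moreover have "{1..} \<subseteq> range nat_of_num"
  proof
    fix n :: nat assume "n \<in> {1..}"
    then have "nat_of_num (num_of_nat n) = n" by (simp add: num_of_nat_inverse)
    then show "n \<in> range nat_of_num" by (metis rangeI)
  qed
  ultimately show False using infinite_Ici finite_subset by blast
qed

section \<open>Complete homogeneous symmetric functions in terms of power sums\<close>

lift_definition complete_mps :: "nat \<Rightarrow> 'v mps" is "\<lambda>n m. if size m = n then 1 else 0" .

lemma coeff_complete: "mps_coeff (complete_mps n) m = (if size m = n then 1 else 0)"
  by transfer simp

text \<open>At a monomial \<open>m\<close> of degree \<open>n\<close> each pair of a variable
  \<open>i\<close> and a \<open>k\<close> with \<open>1 \<le> k \<le> count m i\<close> contributes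
  1, and there are \<open>n\<close> such pairs; at other monomials both sides vanish.\<close>

lemma newton_complete:
  "of_nat n * mps_coeff (complete_mps n) m
    = (\<Sum>k\<in>{1..n}. mps_coeff (power_sum k * complete_mps (n - k)) m)"
proof -
  have size: "size (m - replicate_mset k i) = n - k \<longleftrightarrow> size m = n" if "k \<in> {1..n}" "k \<le> count m i" for k i
  proof -
    have "replicate_mset k i \<subseteq># m" using that by (simp add: count_le_replicate_mset_subset_eq)
    then show ?thesis using that size_mset_mono[of "replicate_mset k i" m] by (auto simp: size_Diff_submset)
  qed
  have "(\<Sum>k\<in>{1..n}. mps_coeff (power_sum k * complete_mps (n - k)) m)
      = (\<Sum>k\<in>{1..n}. \<Sum>i | i \<in># m \<and> k \<le> count m i. if size m = n then 1 else 0)"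
    by (intro sum.cong refl) (auto simp: coeff_power_sum_times coeff_complete size intro!: sum.cong)
  also have "\<dots> = (if size m = n then \<Sum>k\<in>{1..n}. \<Sum>i | i \<in># m \<and> k \<le> count m i. 1 else 0)"
    by simp
  also have "\<dots> = (if size m = n then of_nat n else 0)"
  proof (cases "size m = n")
    case True
    have "(\<Sum>k\<in>{1..n}. \<Sum>i | i \<in># m \<and> k \<le> count m i. 1 :: rat)
        = (\<Sum>k\<in>{1..n}. \<Sum>i\<in>set_mset m. if k \<le> count m i then 1 else 0)"
      by (intro sum.cong refl sum.inter_filter) simp
    also have "\<dots> = (\<Sum>i\<in>set_mset m. \<Sum>k\<in>{1..n}. if k \<le> count m i then 1 else 0)"
      by (rule sum.swap)
    also have "\<dots> = (\<Sum>i\<in>set_mset m. of_nat (count m i))"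
    proof (rule sum.cong[OF refl])
      fix i assume "i \<in># m"
      have "count m i \<le> n" using True count_le_size by metis
      then have "{k \<in> {1..n}. k \<le> count m i} = {1..count m i}" by auto
      then show "(\<Sum>k\<in>{1..n}. if k \<le> count m i then 1 else 0) = (of_nat (count m i) :: rat)"
        by (simp add: sum.If_cases Int_def)
    qed
    also have "\<dots> = of_nat n" using True by (simp add: size_multiset_overloaded_eq flip: of_nat_sum)
    finally show ?thesis using True by simp
  qed simp
  finally show ?thesis by (simp add: coeff_complete)
qed

text \<open>Removing a part \<open>k\<close> costs one factor \<open>k\<close> and the last factor
  \<open>count \<nu> k\<close> of the factorial. This recurrence is the counterpart of Newton's
  identity.\<close>

lemma z_part_remove:
  assumes "k \<in># \<nu>"
  shows "z_part \<nu> = k * count \<nu> k * z_part (\<nu> - {#k#})"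
proof -
  let ?f = "\<lambda>\<nu> i. i ^ count \<nu> i * fact (count \<nu> i) :: nat"
  have "z_part (\<nu> - {#k#}) = (\<Prod>i\<in>set_mset \<nu>. ?f (\<nu> - {#k#}) i)"
    unfolding z_part_def
    by (rule prod.mono_neutral_left) (auto dest: in_diffD simp: not_in_iff)
  also have "\<dots> = ?f (\<nu> - {#k#}) k * (\<Prod>i\<in>set_mset \<nu> - {k}. ?f (\<nu> - {#k#}) i)"
    using assms by (simp add: prod.remove)
  also have "(\<Prod>i\<in>set_mset \<nu> - {k}. ?f (\<nu> - {#k#}) i) = (\<Prod>i\<in>set_mset \<nu> - {k}. ?f \<nu> i)"
    by (intro prod.cong) auto
  finally have *: "z_part (\<nu> - {#k#}) = ?f (\<nu> - {#k#}) k * (\<Prod>i\<in>set_mset \<nu> - {k}. ?f \<nu> i)" .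
  obtain c where c: "count \<nu> k = Suc c" using assms by (metis count_eq_zero_iff not0_implies_Suc)
  have "z_part \<nu> = ?f \<nu> k * (\<Prod>i\<in>set_mset \<nu> - {k}. ?f \<nu> i)"
    unfolding z_part_def using assms by (simp add: prod.remove)
  with * c show ?thesis by (simp add: algebra_simps)
qed

definition partitions_of :: "nat \<Rightarrow> nat multiset set" where
  "partitions_of n = {\<nu> \<in> partitions. \<Sum>\<^sub># \<nu> = n}"

lemma sum_mset_eq_sum_count:
  assumes "finite S" "set_mset \<nu> \<subseteq> S"
  shows "\<Sum>\<^sub># \<nu> = (\<Sum>k\<in>S. k * count \<nu> k)"
  using assms(2)
proof (induction \<nu>)
  case (add x \<nu>)
  have "(\<Sum>k\<in>S. k * count (add_mset x \<nu>) k) = (\<Sum>k\<in>S. k * count \<nu> k + (if k = x then x else 0))"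
    by (intro sum.cong) auto
  also have "\<dots> = (\<Sum>k\<in>S. k * count \<nu> k) + x"
    using add.prems assms(1) by (simp add: sum.distrib)
  finally show ?case using add by simp
qed simp

lemma finite_partitions_of: "finite (partitions_of n)"
proof -
  have "\<nu> \<in> mset ` {xs. set xs \<subseteq> {1..n} \<and> length xs \<le> n}" if "\<nu> \<in> partitions_of n" for \<nu>
  proof -
    obtain xs where xs: "mset xs = \<nu>" using ex_mset by blast
    have "size \<nu> \<le> \<Sum>\<^sub># \<nu>" if "\<nu> \<in> partitions" for \<nu> :: "nat multiset"
      using that by (induction \<nu>) (auto simp: partitions_add)
    then have "size \<nu> \<le> n" using that by (auto simp: partitions_of_def)
    then have "length xs \<le> n" using xs by (metis size_mset)
    moreover have "k \<in> {1..n}" if "k \<in># \<nu>" for k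
    proof -
      have "\<Sum>\<^sub># \<nu> = k + \<Sum>\<^sub># (\<nu> - {#k#})" using that by (rule sum_mset.remove)
      then show ?thesis
        using partitions_pos[OF _ that] \<open>\<nu> \<in> partitions_of n\<close> by (simp add: partitions_of_def Suc_le_eq)
    qed
    ultimately have "set xs \<subseteq> {1..n} \<and> length xs \<le> n" using xs by auto
    then show ?thesis using xs by blast
  qed
  then have "partitions_of n \<subseteq> mset ` {xs. set xs \<subseteq> {1..n} \<and> length xs \<le> n}" by blast
  then show ?thesis by (rule finite_subset) (intro finite_imageI finite_lists_length_le, simp)
qed

text \<open>Induction through Newton's identity. For fixed \<nu> the contributions of its distinct
  parts \<open>k\<close> add up by \<open>z_part_remove\<close> to the sum of
  \<open>k * count \<nu> k\<close> divided by \<open>z_part \<nu>\<close>, that is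
  \<open>n / z_part \<nu>\<close>.\<close>

lemma complete_eq_sum_power_sum_part:
  "mps_coeff (complete_mps n) m
    = (\<Sum>\<nu>\<in>partitions_of n. mps_coeff (power_sum_part \<nu>) m / of_nat (z_part \<nu>))"
proof (induction n arbitrary: m rule: less_induct)
  case (less n)
  let ?T = "\<lambda>\<nu>. mps_coeff (power_sum_part \<nu>) m"
  show ?case
  proof (cases "n = 0")
    case True
    have "\<nu> = {#}" if "\<nu> \<in> partitions_of 0" for \<nu>
      using that by (cases \<nu>) (auto simp: partitions_of_def partitions_add)
    then have "partitions_of 0 = {{#}}" by (auto simp: partitions_of_def)
    then show ?thesis using True by (simp add: coeff_complete coeff_one z_part_def)
  next
    case False
    have "(\<Sum>k\<in>{1..n}. mps_coeff (power_sum k * complete_mps (n - k)) m)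
        = (\<Sum>k\<in>{1..n}. \<Sum>\<nu>\<in>partitions_of (n - k). ?T (add_mset k \<nu>) / of_nat (z_part \<nu>))"
    proof (rule sum.cong[OF refl])
      fix k assume k: "k \<in> {1..n}"
      then have "mps_coeff (power_sum k * complete_mps (n - k)) m =
        (\<Sum>i | i \<in># m \<and> k \<le> count m i. \<Sum>\<nu>\<in>partitions_of (n - k).
          mps_coeff (power_sum_part \<nu>) (m - replicate_mset k i) / of_nat (z_part \<nu>))"
        using less False by (simp add: coeff_power_sum_times)
      also have "\<dots> = (\<Sum>\<nu>\<in>partitions_of (n - k). ?T (add_mset k \<nu>) / of_nat (z_part \<nu>))"
        using k by (subst sum.swap) (simp add: power_sum_part_add coeff_power_sum_times sum_divide_distrib)
      finally show "mps_coeff (power_sum k * complete_mps (n - k)) m = \<dots>" .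
    qed
    also have "\<dots> = (\<Sum>(k, \<nu>)\<in>Sigma {1..n} (\<lambda>k. partitions_of (n - k)).
        ?T (add_mset k \<nu>) / of_nat (z_part \<nu>))"
      by (intro sum.Sigma) (auto simp: finite_partitions_of)
    \<comment> \<open>A pair of \<open>k\<close> and a partition of \<open>n - k\<close> is a
      partition of \<open>n\<close> with one of its distinct part sizes marked.\<close>
    also have "\<dots> = (\<Sum>(\<nu>, k)\<in>Sigma (partitions_of n) set_mset.
        ?T \<nu> / of_nat (z_part (\<nu> - {#k#})))"
      by (rule sum.reindex_bij_witness[of _ "\<lambda>(\<nu>, k). (k, \<nu> - {#k#})" "\<lambda>(k, \<nu>). (add_mset k \<nu>, k)"])
        (auto simp: partitions_of_def partitions_add partitions_pos Suc_le_eq sum_mset.remove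
          partitions_remove)
    also have "\<dots> = (\<Sum>\<nu>\<in>partitions_of n. \<Sum>k\<in>set_mset \<nu>. ?T \<nu> / of_nat (z_part (\<nu> - {#k#})))"
      by (intro sum.Sigma[symmetric]) (auto simp: finite_partitions_of)
    also have "\<dots> = (\<Sum>\<nu>\<in>partitions_of n. of_nat n * (?T \<nu> / of_nat (z_part \<nu>)))"
    proof (rule sum.cong[OF refl])
      fix \<nu> assume \<nu>: "\<nu> \<in> partitions_of n"
      have "(\<Sum>k\<in>set_mset \<nu>. ?T \<nu> / of_nat (z_part (\<nu> - {#k#})))
          = (\<Sum>k\<in>set_mset \<nu>. of_nat (k * count \<nu> k) * (?T \<nu> / of_nat (z_part \<nu>)))"
      proof (rule sum.cong[OF refl])
        fix k assume k: "k \<in># \<nu>"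
        have "k > 0" "count \<nu> k > 0" using k \<nu> partitions_pos by (auto simp: partitions_of_def)
        then show "?T \<nu> / of_nat (z_part (\<nu> - {#k#}))
            = of_nat (k * count \<nu> k) * (?T \<nu> / of_nat (z_part \<nu>))"
          by (simp add: z_part_remove[OF k] del: count_greater_zero_iff)
      qed
      also have "\<dots> = of_nat n * (?T \<nu> / of_nat (z_part \<nu>))"
        unfolding sum_distrib_right[symmetric] of_nat_sum[symmetric]
        using \<nu> sum_mset_eq_sum_count[OF finite_set_mset order_refl, of \<nu>]
        by (simp add: partitions_of_def)
      finally show "(\<Sum>k\<in>set_mset \<nu>. ?T \<nu> / of_nat (z_part (\<nu> - {#k#}))) = \<dots>" .
    qed
    finally have "of_nat n * mps_coeff (complete_mps n) m
        = of_nat n * (\<Sum>\<nu>\<in>partitions_of n. ?T \<nu> / of_nat (z_part \<nu>))"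
      by (simp only: newton_complete flip: sum_distrib_left)
    with False show ?thesis by simp
  qed
qed

section \<open>Twisted orbit counting\<close>

text \<open>Every \<open>\<tau>\<close> maps a given point \<open>y\<close> of an orbit to exactly one point of the orbit, and if \<open>\<phi> x\<close>
  lies in the orbit, then as many \<open>\<tau>\<close> take \<open>\<phi> x\<close> to \<open>x\<close> as take \<open>y\<close> to \<open>x\<close>.\<close>

lemma card_fixed_orbits:
  fixes \<alpha> :: "(nat \<Rightarrow> nat) \<Rightarrow> 'x \<Rightarrow> 'x"
  assumes X: "finite X"
    and closed: "\<And>\<tau> x. \<tau> permutes {1..m} \<Longrightarrow> x \<in> X \<Longrightarrow> \<alpha> \<tau> x \<in> X"
    and id: "\<And>x. x \<in> X \<Longrightarrow> \<alpha> id x = x"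
    and comp: "\<And>\<tau> \<rho> x. \<tau> permutes {1..m} \<Longrightarrow> \<rho> permutes {1..m} \<Longrightarrow> x \<in> X \<Longrightarrow>
      \<alpha> (\<tau> \<circ> \<rho>) x = \<alpha> \<tau> (\<alpha> \<rho> x)"
    and \<phi>: "\<And>x. x \<in> X \<Longrightarrow> \<phi> x \<in> X"
    and comm: "\<And>\<tau> x. \<tau> permutes {1..m} \<Longrightarrow> x \<in> X \<Longrightarrow> \<phi> (\<alpha> \<tau> x) = \<alpha> \<tau> (\<phi> x)"
  defines "orb \<equiv> \<lambda>x. {\<alpha> \<tau> x | \<tau>. \<tau> permutes {1..m}}"
  shows "fact m * card {Q \<in> orb ` X. \<phi> ` Q = Q} = (\<Sum>\<tau> | \<tau> permutes {1..m}. card {x \<in> X. \<alpha> \<tau> (\<phi> x) = x})"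
proof -
  let ?P = "{\<tau>. \<tau> permutes {1..m}}"
  let ?n = "\<lambda>y x. card {\<tau> \<in> ?P. \<alpha> \<tau> y = x}"
  have P: "finite ?P" "card ?P = fact m"
    by (simp_all add: finite_permutations card_permutations)
  have self: "x \<in> orb x" if "x \<in> X" for x
    unfolding orb_def using id[OF that] permutes_id by (metis (mono_tags, lifting) mem_Collect_eq)
  have sub: "orb x \<subseteq> X" if "x \<in> X" for x using closed that by (auto simp: orb_def)
  \<comment> \<open>Right multiplication by \<rho> matches the permutations that take
    \<open>\<alpha> \<rho> y\<close> to \<open>x\<close> with those that take \<open>y\<close> to
    \<open>x\<close>.\<close>
  have shift: "?n (\<alpha> \<rho> y) x = ?n y x" if "y \<in> X" "\<rho> permutes {1..m}" for \<rho> y x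
  proof (rule bij_betw_same_card)
    show "bij_betw (\<lambda>\<tau>. \<tau> \<circ> \<rho>) {\<tau> \<in> ?P. \<alpha> \<tau> (\<alpha> \<rho> y) = x} {\<tau> \<in> ?P. \<alpha> \<tau> y = x}"
    proof (rule bij_betw_byWitness[where f' = "\<lambda>\<tau>. \<tau> \<circ> inv \<rho>"])
      show "(\<lambda>\<tau>. \<tau> \<circ> \<rho>) ` {\<tau> \<in> ?P. \<alpha> \<tau> (\<alpha> \<rho> y) = x} \<subseteq> {\<tau> \<in> ?P. \<alpha> \<tau> y = x}"
        using that by (auto simp: comp intro: permutes_compose)
      show "(\<lambda>\<tau>. \<tau> \<circ> inv \<rho>) ` {\<tau> \<in> ?P. \<alpha> \<tau> y = x} \<subseteq> {\<tau> \<in> ?P. \<alpha> \<tau> (\<alpha> \<rho> y) = x}"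
      proof (rule image_subsetI)
        fix \<tau> assume "\<tau> \<in> {\<tau> \<in> ?P. \<alpha> \<tau> y = x}"
        then have \<tau>: "\<tau> permutes {1..m}" "\<alpha> \<tau> y = x" by auto
        have "\<tau> \<circ> inv \<rho> permutes {1..m}" using \<tau>(1) that permutes_compose permutes_inv by blast
        moreover from this have "\<alpha> (\<tau> \<circ> inv \<rho>) (\<alpha> \<rho> y) = \<alpha> (\<tau> \<circ> inv \<rho> \<circ> \<rho>) y"
          using that by (simp add: comp)
        ultimately show "\<tau> \<circ> inv \<rho> \<in> {\<tau> \<in> ?P. \<alpha> \<tau> (\<alpha> \<rho> y) = x}"
          using permutes_inv_o(2)[OF that(2)] \<tau>(2) by (simp add: comp_assoc)
      qed
    qed (use that in \<open>auto simp: fun_eq_iff permutes_inverses\<close>)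
  qed
  have orb_eq: "orb z = orb x" if x: "x \<in> X" and z: "z \<in> orb x" for x z
  proof -
    from z obtain \<rho> where \<rho>: "\<rho> permutes {1..m}" "z = \<alpha> \<rho> x" by (auto simp: orb_def)
    have "w \<in> orb z \<longleftrightarrow> w \<in> orb x" if "w \<in> X" for w
    proof -
      have "w \<in> orb v \<longleftrightarrow> ?n v w \<noteq> 0" for v
        using P by (auto simp: orb_def)
      then show ?thesis using shift[OF x \<rho>(1)] \<rho>(2) by simp
    qed
    then show ?thesis using sub x z by blast
  qed
  have img: "\<phi> ` orb x = orb (\<phi> x)" if "x \<in> X" for x
    unfolding orb_def using comm[OF _ that] by (force simp: image_iff)
  have orbit_sum: "(\<Sum>x\<in>Q. ?n (\<phi> x) x) = (if \<phi> ` Q = Q then fact m else 0)" if Q: "Q \<in> orb ` X" for Q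
  proof -
    obtain y where y: "y \<in> X" "Q = orb y" using Q by blast
    \<comment> \<open>\<phi> commutes with the action and so maps orbits onto orbits; one point of
      \<open>Q\<close> decides for the whole orbit.\<close>
    have fixed: "\<phi> ` Q = Q \<longleftrightarrow> \<phi> x \<in> Q" if "x \<in> Q" for x
    proof
      have x: "x \<in> X" "orb x = Q"
        using that sub[OF y(1)] orb_eq[OF y(1), of x] unfolding y(2) by auto
      assume "\<phi> x \<in> Q"
      then have "orb (\<phi> x) = Q" using orb_eq[OF y(1), of "\<phi> x"] unfolding y(2) by simp
      then show "\<phi> ` Q = Q" using img[OF x(1)] x(2) by simp
    qed (use that in blast)
    show ?thesis
    proof (cases "\<phi> ` Q = Q")
      case True
      have "?n (\<phi> x) x = ?n y x" if "x \<in> Q" for x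
      proof -
        have "\<phi> x \<in> orb y" using fixed[OF that] True y by simp
        then obtain \<rho> where "\<rho> permutes {1..m}" "\<phi> x = \<alpha> \<rho> y" by (auto simp: orb_def)
        then show ?thesis using shift y by simp
      qed
      then have "(\<Sum>x\<in>Q. ?n (\<phi> x) x) = (\<Sum>x\<in>Q. ?n y x)" by simp
      also have "\<dots> = card (\<Union>x\<in>Q. {\<tau> \<in> ?P. \<alpha> \<tau> y = x})"
        using P sub[OF y(1)] y(2) X finite_subset by (subst card_UN_disjoint) auto
      also have "(\<Union>x\<in>Q. {\<tau> \<in> ?P. \<alpha> \<tau> y = x}) = ?P" using y by (auto simp: orb_def)
      finally show ?thesis using True P by simp
    next
      case False
      have "?n (\<phi> x) x = 0" if "x \<in> Q" for x
      proof -
        have "x \<in> X" using that y sub by auto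
        have "x \<notin> orb (\<phi> x)"
        proof
          assume "x \<in> orb (\<phi> x)"
          then have "orb x = orb (\<phi> x)" using orb_eq[OF \<phi>[OF \<open>x \<in> X\<close>]] by simp
          then have "\<phi> x \<in> Q" using self[OF \<phi>[OF \<open>x \<in> X\<close>]] orb_eq[OF y(1), of x] that y(2) by simp
          then show False using fixed[OF that] False by simp
        qed
        then have none: "{\<tau> \<in> ?P. \<alpha> \<tau> (\<phi> x) = x} = {}" by (auto simp: orb_def)
        show ?thesis unfolding none by simp
      qed
      then show ?thesis using False by simp
    qed
  qed
  have Un: "\<Union> (orb ` X) = X" using self sub by blast
  \<comment> \<open>Double counting of the pairs \<open>(\<tau>, x)\<close> with
    \<open>\<alpha> \<tau> (\<phi> x) = x\<close>.\<close>
  have "(\<Sum>\<tau>\<in>?P. card {x \<in> X. \<alpha> \<tau> (\<phi> x) = x}) = (\<Sum>x\<in>X. ?n (\<phi> x) x)"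
    using sum.swap_restrict[OF P(1) X, of "\<lambda>_ _. 1 :: nat" "\<lambda>\<tau> x. \<alpha> \<tau> (\<phi> x) = x"] by simp
  also have "\<dots> = (\<Sum>x\<in>\<Union> (orb ` X). ?n (\<phi> x) x)" by (simp only: Un)
  also have "\<dots> = (\<Sum>Q\<in>orb ` X. \<Sum>x\<in>Q. ?n (\<phi> x) x)"
  proof (rule sum.Union_disjoint[unfolded comp_def])
    show "\<forall>Q\<in>orb ` X. finite Q" using sub X finite_subset by blast
    show "\<forall>Q\<in>orb ` X. \<forall>Q'\<in>orb ` X. Q \<noteq> Q' \<longrightarrow> Q \<inter> Q' = {}" using orb_eq by blast
  qed
  also have "\<dots> = (\<Sum>Q\<in>orb ` X. if \<phi> ` Q = Q then fact m else 0)"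
    by (rule sum.cong[OF refl orbit_sum])
  also have "\<dots> = fact m * card {Q \<in> orb ` X. \<phi> ` Q = Q}"
    using X by (simp add: sum.If_cases Int_def mult.commute)
  finally show ?thesis by simp
qed

section \<open>Functions equivariant along a permutation\<close>

lemma finite_fibres_repeat_mset:
  assumes "k > 0" "finite_fibres A wt"
  shows "finite_fibres A (\<lambda>a. repeat_mset k (wt a))"
  unfolding finite_fibres_def
proof
  fix m
  show "finite {a \<in> A. repeat_mset k (wt a) = m}"
  proof (cases "\<exists>m'. repeat_mset k m' = m")
    case True
    then obtain m' where m': "m = repeat_mset k m'" by auto
    have "{a \<in> A. repeat_mset k (wt a) = m} = {a \<in> A. wt a = m'}"
      unfolding m' by (simp add: repeat_mset_cancel[OF assms(1)] del: repeat_mset_cancel1)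
    then show ?thesis using assms(2) by (simp add: finite_fibres_def)
  next
    case False
    then have "{a \<in> A. repeat_mset k (wt a) = m} = {}" by auto
    then show ?thesis by (simp only: finite.emptyI)
  qed
qed

text \<open>\<open>\<Psi>\<close> records the values of an equivariant \<open>f\<close> at one
  representative per cycle; a cycle \<open>c\<close> admits precisely the values fixed by
  \<open>h ^^ card c\<close>. As \<open>h\<close> preserves \<open>wt\<close>, all points of
  \<open>c\<close> have values of the same degree, which therefore counts \<open>card c\<close>
  times.\<close>

lemma enumerator_equivariant:
  assumes \<tau>: "\<tau> permutes {1..m}" and ff: "finite_fibres A wt"
    and h: "\<And>a. a \<in> A \<Longrightarrow> h a \<in> A" and wt: "\<And>a. a \<in> A \<Longrightarrow> wt (h a) = wt a"
  shows "enumerator {f \<in> {1..m} \<rightarrow>\<^sub>E A. \<forall>i\<in>{1..m}. f (\<tau> i) = h (f i)} (\<lambda>f. \<Sum>i\<in>{1..m}. wt (f i)) =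
    (\<Prod>k\<in>#cycle_type m \<tau>. enumerator {a \<in> A. (h ^^ k) a = a} (\<lambda>a. repeat_mset k (wt a)))"
proof -
  let ?I = "orbit \<tau> ` {1..m}" and ?D = "{f \<in> {1..m} \<rightarrow>\<^sub>E A. \<forall>i\<in>{1..m}. f (\<tau> i) = h (f i)}"
  let ?E = "\<lambda>c. {a \<in> A. (h ^^ card c) a = a}"
  define r where "r = (\<lambda>c :: nat set. SOME i. i \<in> c)"
  define \<Psi> where "\<Psi> = (\<lambda>f :: nat \<Rightarrow> 'a. restrict (\<lambda>c. f (r c)) ?I)"
  have r: "r c \<in> c" if "c \<in> ?I" for c
    unfolding r_def by (rule someI_ex) (use that orbit_nonempty in fastforce)
  have rI: "r c \<in> {1..m}" if "c \<in> ?I" for c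
    using r[OF that] Union_orbits[OF \<tau>] that by blast
  have orb_r: "orbit \<tau> (r c) = c" if "c \<in> ?I" for c
    using orbit_eq[OF \<tau>] r[OF that] that by auto
  have hA: "(h ^^ j) a \<in> A \<and> wt ((h ^^ j) a) = wt a" if "a \<in> A" for a j
    using that by (induction j) (auto simp: h wt)
  have along: "f ((\<tau> ^^ j) i) = (h ^^ j) (f i)" if "f \<in> ?D" "i \<in> {1..m}" for f i j
    by (rule equivariant_funpow[OF \<tau> _ that(2)]) (use that(1) in blast)
  have on_orbit: "\<exists>j. i = (\<tau> ^^ j) (r (orbit \<tau> i))" if "i \<in> {1..m}" for i
  proof -
    have "i \<in> orbit \<tau> (r (orbit \<tau> i))" using orb_r orbit_refl[OF \<tau>] that by simp
    then show ?thesis unfolding orbit_funpow[OF \<tau>] by blast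
  qed
  have fA: "f i \<in> A" if "f \<in> ?D" "i \<in> {1..m}" for f i
    using that by (auto simp: PiE_iff)
  have bij: "bij_betw \<Psi> ?D (PiE ?I ?E)"
    unfolding bij_betw_def
  proof
    show "inj_on \<Psi> ?D"
    proof (rule inj_onI)
      fix f f' assume f: "f \<in> ?D" "f' \<in> ?D" and eq: "\<Psi> f = \<Psi> f'"
      have "f i = f' i" if i: "i \<in> {1..m}" for i
      proof -
        obtain j where j: "i = (\<tau> ^^ j) (r (orbit \<tau> i))" using on_orbit[OF i] by blast
        have "orbit \<tau> i \<in> ?I" using i by simp
        then have "f (r (orbit \<tau> i)) = f' (r (orbit \<tau> i))" and "r (orbit \<tau> i) \<in> {1..m}"
          using fun_cong[OF eq, of "orbit \<tau> i"] rI by (auto simp: \<Psi>_def)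
        then show ?thesis using along[OF f(1)] along[OF f(2)] j by metis
      qed
      moreover have "f \<in> extensional {1..m}" "f' \<in> extensional {1..m}" using f by (auto simp: PiE_def)
      ultimately show "f = f'" by (intro extensionalityI[of f "{1..m}" f'])
    qed
    show "\<Psi> ` ?D = PiE ?I ?E"
    proof
      show "\<Psi> ` ?D \<subseteq> PiE ?I ?E"
      proof (rule image_subsetI)
        fix f assume f: "f \<in> ?D"
        have "f (r c) \<in> ?E c" if c: "c \<in> ?I" for c
          using along[OF f rI[OF c], of "card c"] funpow_card_orbit(1)[OF \<tau>, of "r c"] orb_r[OF c]
            fA[OF f rI[OF c]] by simp
        then show "\<Psi> f \<in> PiE ?I ?E" by (simp add: \<Psi>_def)
      qed
      show "PiE ?I ?E \<subseteq> \<Psi> ` ?D"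
      proof
        fix b assume b: "b \<in> PiE ?I ?E"
        obtain f where f: "\<And>i. i \<in> {1..m} \<Longrightarrow> f (\<tau> i) = h (f i)"
          "\<And>c. c \<in> ?I \<Longrightarrow> f (r c) = b c"
          "\<And>i. i \<in> {1..m} \<Longrightarrow> \<exists>j. f i = (h ^^ j) (b (orbit \<tau> i))"
        proof (rule equivariant_extension[OF \<tau>, of r h b])
          show "(h ^^ card c) (b c) = b c" if "c \<in> ?I" for c using PiE_mem[OF b that] by simp
        qed (use r in auto)
        have "f i \<in> A" if i: "i \<in> {1..m}" for i
        proof -
          have "b (orbit \<tau> i) \<in> A" using PiE_mem[OF b imageI[OF i]] by simp
          then show ?thesis using f(3)[OF i] hA by auto
        qed
        moreover have "\<tau> i \<in> {1..m}" if "i \<in> {1..m}" for i using that \<tau> by (simp only: permutes_in_image)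
        ultimately have "restrict f {1..m} \<in> ?D" using f(1) by (simp del: atLeastAtMost_iff)
        moreover have "\<Psi> (restrict f {1..m}) = b"
        proof (rule extensionalityI[of _ ?I])
          show "\<Psi> (restrict f {1..m}) c = b c" if "c \<in> ?I" for c
            using that rI[OF that] f(2)[OF that] by (simp add: \<Psi>_def del: atLeastAtMost_iff)
        qed (use b in \<open>auto simp: \<Psi>_def PiE_def\<close>)
        ultimately show "b \<in> \<Psi> ` ?D" by blast
      qed
    qed
  qed
  have weight: "(\<Sum>c\<in>?I. repeat_mset (card c) (wt (\<Psi> f c))) = (\<Sum>i\<in>{1..m}. wt (f i))" if f: "f \<in> ?D" for f
  proof -
    have "(\<Sum>i\<in>c. wt (f i)) = repeat_mset (card c) (wt (\<Psi> f c))" if c: "c \<in> ?I" for c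
    proof -
      have "wt (f i) = wt (\<Psi> f c)" if "i \<in> c" for i
      proof -
        have "i \<in> orbit \<tau> (r c)" using that orb_r[OF c] by simp
        then obtain j where "i = (\<tau> ^^ j) (r c)" unfolding orbit_funpow[OF \<tau>] by blast
        then have "wt (f i) = wt (f (r c))"
          using along[OF f rI[OF c]] hA[OF fA[OF f rI[OF c]]] by simp
        then show ?thesis using c by (simp add: \<Psi>_def)
      qed
      then have "(\<Sum>i\<in>c. wt (f i)) = (\<Sum>i\<in>c. wt (\<Psi> f c))" by simp
      also have "\<dots> = repeat_mset (card c) (wt (\<Psi> f c))"
        by (rule multiset_eqI) (simp add: count_sum)
      finally show ?thesis .
    qed
    then show ?thesis unfolding sum_orbits[OF \<tau>] by (intro sum.cong[OF refl]) simp
  qed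
  \<comment> \<open>Lengths must be positive, as \<open>repeat_mset 0\<close> could put infinitely
    many elements into one fibre.\<close>
  have card_pos: "card c > 0" if "c \<in> ?I" for c
    using that finite_orbit_perm[OF \<tau>] orbit_nonempty[of \<tau>] by (auto simp: card_gt_0_iff)
  have ff': "finite_fibres (?E c) (\<lambda>a. repeat_mset (card c) (wt a))" if "c \<in> ?I" for c
    by (rule finite_fibres_subset[OF finite_fibres_repeat_mset[OF card_pos[OF that] ff]]) auto
  have "enumerator ?D (\<lambda>f. \<Sum>i\<in>{1..m}. wt (f i))
      = enumerator (PiE ?I ?E) (\<lambda>b. \<Sum>c\<in>?I. repeat_mset (card c) (wt (b c)))"
    by (rule enumerator_reindex[where wt' = "\<lambda>b. \<Sum>c\<in>?I. repeat_mset (card c) (wt (b c))", OF bij weight])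
  also have "\<dots> = (\<Prod>c\<in>?I. enumerator (?E c) (\<lambda>a. repeat_mset (card c) (wt a)))"
    by (rule enumerator_PiE[OF _ ff']) auto
  finally show ?thesis by (simp add: prod_cycle_type)
qed

section \<open>Fixed points of analytic functors\<close>

definition analytic_degree :: "('a \<Rightarrow> 'v multiset) \<Rightarrow> ('s, 'a) analytic \<Rightarrow> 'v multiset" where
  "analytic_degree wt = (\<lambda>(m, orb). \<Sum>i\<in>{1..m}. wt (snd (SOME p. p \<in> orb) i))"

lemma analytic_weight_monom:
  "analytic_weight (\<lambda>a. mps_monom (wt a)) = (\<lambda>e. mps_monom (analytic_degree wt e))"
  by (auto simp: analytic_weight_def analytic_degree_def mps_monom_sum)

text \<open>The representative picked by \<open>SOME\<close> is
  \<open>(act \<tau> t, f \<circ> inv \<tau>)\<close> for some \<tau>, and reindexing the sum by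
  \<open>inv \<tau>\<close> removes \<tau>.\<close>

lemma analytic_degree_orbit:
  "analytic_degree wt (m, sym_orbit act m (t, f)) = (\<Sum>i\<in>{1..m}. wt (f i))"
proof -
  let ?Q = "sym_orbit act m (t, f)"
  have "(act id t, f \<circ> inv id) \<in> ?Q" unfolding sym_orbit_def by (auto intro!: exI[of _ id])
  then have "(SOME p. p \<in> ?Q) \<in> ?Q" by (rule someI)
  then obtain \<tau> where \<tau>: "\<tau> permutes {1..m}" "(SOME p. p \<in> ?Q) = (act \<tau> t, f \<circ> inv \<tau>)"
    unfolding sym_orbit_def by auto
  have "(\<Sum>i\<in>{1..m}. wt (f (inv \<tau> i))) = (\<Sum>i\<in>{1..m}. wt (f i))"
    by (rule sum.reindex_bij_betw[OF permutes_imp_bij[OF permutes_inv[OF \<tau>(1)]]])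
  then show ?thesis by (simp add: analytic_degree_def \<tau>(2))
qed

lemma comp_inv_PiE:
  assumes "f \<in> {1..m} \<rightarrow>\<^sub>E A" "\<tau> permutes {1..m}"
  shows "f \<circ> inv \<tau> \<in> {1..m} \<rightarrow>\<^sub>E A"
proof (rule PiE_I)
  note inv = permutes_inv[OF assms(2)]
  show "(f \<circ> inv \<tau>) i \<in> A" if "i \<in> {1..m}" for i
    using PiE_mem[OF assms(1), of "inv \<tau> i"] that permutes_in_image[OF inv, of i] by (simp del: atLeastAtMost_iff)
  show "(f \<circ> inv \<tau>) i = undefined" if "i \<notin> {1..m}" for i
    using PiE_arb[OF assms(1) that] permutes_not_in[OF inv that] by simp
qed

lemma restrict_comp_inv:
  assumes "\<tau> permutes {1..m}"
  shows "restrict (h \<circ> (f \<circ> inv \<tau>)) {1..m} = restrict (h \<circ> f) {1..m} \<circ> inv \<tau>"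
proof
  fix i
  show "restrict (h \<circ> (f \<circ> inv \<tau>)) {1..m} i = (restrict (h \<circ> f) {1..m} \<circ> inv \<tau>) i"
    using permutes_in_image[OF permutes_inv[OF assms], of i] by (simp del: atLeastAtMost_iff)
qed

text \<open>Setting shared by three counts: \<open>g\<close> acts on the structures and
  \<open>h\<close> on the values. For \<open>G\<close> on P_x the permutation \<sigma> enters
  through \<open>g\<close>, and \<open>h = id\<close>; for \<open>F\<close> on G(P_x, [n]) it enters
  through \<open>h\<close>, and \<open>g\<close> is the identity; with a single structure for each
  \<open>m\<close> and both maps trivial the orbits are multisets.\<close>

locale equivariant_family =
  fixes S :: "nat \<Rightarrow> 's set" and act :: "nat \<Rightarrow> (nat \<Rightarrow> nat) \<Rightarrow> 's \<Rightarrow> 's" and g :: "nat \<Rightarrow> 's \<Rightarrow> 's"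
    and A :: "'a set" and wt :: "'a \<Rightarrow> 'v multiset" and h :: "'a \<Rightarrow> 'a"
  assumes finite_S: "finite (S m)"
    and act_closed: "\<tau> permutes {1..m} \<Longrightarrow> t \<in> S m \<Longrightarrow> act m \<tau> t \<in> S m"
    and act_id: "t \<in> S m \<Longrightarrow> act m id t = t"
    and act_comp: "\<tau> permutes {1..m} \<Longrightarrow> \<rho> permutes {1..m} \<Longrightarrow> t \<in> S m \<Longrightarrow>
      act m (\<tau> \<circ> \<rho>) t = act m \<tau> (act m \<rho> t)"
    and g_closed: "t \<in> S m \<Longrightarrow> g m t \<in> S m"
    and g_act: "\<tau> permutes {1..m} \<Longrightarrow> t \<in> S m \<Longrightarrow> g m (act m \<tau> t) = act m \<tau> (g m t)"
    and fibres: "finite_fibres A wt"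
    and h_closed: "a \<in> A \<Longrightarrow> h a \<in> A"
    and wt_h: "a \<in> A \<Longrightarrow> wt (h a) = wt a"
begin

lemma orbit_subset_carrier:
  assumes "(m, Q) \<in> analytic_set S act A"
  shows "Q \<subseteq> S m \<times> ({1..m} \<rightarrow>\<^sub>E A)"
proof -
  obtain t f where Q: "Q = sym_orbit (act m) m (t, f)" "t \<in> S m" "f \<in> {1..m} \<rightarrow>\<^sub>E A"
    using assms by (auto simp: analytic_set_def)
  show ?thesis
    unfolding Q(1) sym_orbit_def using act_closed[OF _ Q(2)] comp_inv_PiE[OF Q(3)] by auto
qed

lemma analytic_map_orbit:
  assumes "t \<in> S m"
  shows "analytic_map g h (m, sym_orbit (act m) m (t, f))
    = (m, sym_orbit (act m) m (g m t, restrict (h \<circ> f) {1..m}))"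
proof -
  have "(\<lambda>(t, f). (g m t, restrict (h \<circ> f) {1..m})) ` sym_orbit (act m) m (t, f)
      = (\<lambda>\<tau>. (g m (act m \<tau> t), restrict (h \<circ> (f \<circ> inv \<tau>)) {1..m})) ` {\<tau>. \<tau> permutes {1..m}}"
    by (auto simp: sym_orbit_def image_def)
  also have "\<dots> = (\<lambda>\<tau>. (act m \<tau> (g m t), restrict (h \<circ> f) {1..m} \<circ> inv \<tau>)) ` {\<tau>. \<tau> permutes {1..m}}"
    by (rule image_cong) (auto simp: g_act assms restrict_comp_inv simp del: One_nat_def)
  also have "\<dots> = sym_orbit (act m) m (g m t, restrict (h \<circ> f) {1..m})"
    by (auto simp: sym_orbit_def)
  finally show ?thesis by (simp add: analytic_map_def)
qed

lemma analytic_map_closed: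
  assumes "e \<in> analytic_set S act A"
  shows "analytic_map g h e \<in> analytic_set S act A"
    and "analytic_degree wt (analytic_map g h e) = analytic_degree wt e"
proof -
  obtain m t f where e: "e = (m, sym_orbit (act m) m (t, f))" "t \<in> S m" "f \<in> {1..m} \<rightarrow>\<^sub>E A"
    using assms by (auto simp: analytic_set_def)
  have f: "f i \<in> A" if "i \<in> {1..m}" for i using PiE_mem[OF e(3) that] .
  then have "restrict (h \<circ> f) {1..m} \<in> {1..m} \<rightarrow>\<^sub>E A" by (auto simp: h_closed)
  then show "analytic_map g h e \<in> analytic_set S act A"
    unfolding e(1) analytic_map_orbit[OF e(2)] using g_closed[OF e(2)] by (auto simp: analytic_set_def)
  show "analytic_degree wt (analytic_map g h e) = analytic_degree wt e"
    unfolding e(1) analytic_map_orbit[OF e(2)] analytic_degree_orbit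
    by (rule sum.cong) (use f wt_h in auto)
qed

text \<open>Evaluating the fixed-point equation at \<open>\<tau> i\<close> instead of
  \<open>i\<close> turns it into equivariance, which can be solved cycle by cycle.\<close>

lemma fixed_pair_iff:
  assumes \<tau>: "\<tau> permutes {1..m}" and f: "f \<in> {1..m} \<rightarrow>\<^sub>E A"
  shows "restrict (h \<circ> f) {1..m} \<circ> inv \<tau> = f \<longleftrightarrow> (\<forall>i\<in>{1..m}. f (\<tau> i) = h (f i))"
proof
  assume eq: "restrict (h \<circ> f) {1..m} \<circ> inv \<tau> = f"
  show "\<forall>i\<in>{1..m}. f (\<tau> i) = h (f i)"
  proof
    fix i assume "i \<in> {1..m}"
    then show "f (\<tau> i) = h (f i)"
      using fun_cong[OF eq, of "\<tau> i"] by (simp add: permutes_inverses[OF \<tau>] del: atLeastAtMost_iff)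
  qed
next
  assume eq: "\<forall>i\<in>{1..m}. f (\<tau> i) = h (f i)"
  show "restrict (h \<circ> f) {1..m} \<circ> inv \<tau> = f"
  proof
    fix i
    show "(restrict (h \<circ> f) {1..m} \<circ> inv \<tau>) i = f i"
    proof (cases "i \<in> {1..m}")
      case True
      then have "inv \<tau> i \<in> {1..m}" using permutes_in_image[OF permutes_inv[OF \<tau>]] by simp
      then show ?thesis using bspec[OF eq, of "inv \<tau> i"]
        by (simp add: permutes_inverses[OF \<tau>] del: atLeastAtMost_iff)
    next
      case False
      then show ?thesis using permutes_not_in[OF permutes_inv[OF \<tau>] False] PiE_arb[OF f False]
        by (simp del: atLeastAtMost_iff)
    qed
  qed
qed

abbreviation fixed_of_degree :: "nat \<Rightarrow> 'v multiset \<Rightarrow> ('s, 'a) analytic set" where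
  "fixed_of_degree m \<mu> \<equiv> {e \<in> analytic_set S act A.
     fst e = m \<and> analytic_map g h e = e \<and> analytic_degree wt e = \<mu>}"

abbreviation cycle_weight :: "nat \<Rightarrow> 'v mps" where
  "cycle_weight k \<equiv> enumerator {a \<in> A. (h ^^ k) a = a} (\<lambda>a. repeat_mset k (wt a))"

text \<open>Orbit counting on the pairs \<open>(t, f)\<close> of degree \<mu>: for each \<tau> the
  fixed pairs form a product of structures \<open>t\<close> and equivariant functions
  \<open>f\<close>, and \<open>enumerator_equivariant\<close> counts the latter.\<close>

lemma card_fixed_of_degree:
  "fact m * of_nat (card (fixed_of_degree m \<mu>)) =
    (\<Sum>\<tau> | \<tau> permutes {1..m}. of_nat (card {t \<in> S m. act m \<tau> (g m t) = t}) *
      mps_coeff (\<Prod>k\<in>#cycle_type m \<tau>. cycle_weight k) \<mu>)"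
proof -
  let ?f = "\<lambda>f. \<Sum>i\<in>{1..m}. wt (f i)"
  \<comment> \<open>Fixing the degree makes the set of pairs finite; the action and \<phi> both
    preserve it.\<close>
  define X where "X = S m \<times> {f \<in> {1..m} \<rightarrow>\<^sub>E A. ?f f = \<mu>}"
  define \<alpha> where "\<alpha> = (\<lambda>\<tau> (t, f :: nat \<Rightarrow> 'a). (act m \<tau> t, f \<circ> inv \<tau>))"
  define \<phi> where "\<phi> = (\<lambda>(t, f :: nat \<Rightarrow> 'a). (g m t, restrict (h \<circ> f) {1..m}))"
  have X: "finite X"
    using finite_fibres_PiE[where I = "{1..m}" and E = "\<lambda>_. A" and wt = "\<lambda>_. wt"] fibres finite_S
    by (simp add: X_def finite_fibres_def)
  have sym_orbit: "sym_orbit (act m) m x = {\<alpha> \<tau> x | \<tau>. \<tau> permutes {1..m}}" for x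
    by (cases x) (simp add: sym_orbit_def \<alpha>_def)
  have "fact m * card {Q \<in> sym_orbit (act m) m ` X. \<phi> ` Q = Q}
      = (\<Sum>\<tau> | \<tau> permutes {1..m}. card {x \<in> X. \<alpha> \<tau> (\<phi> x) = x})"
    unfolding sym_orbit
  proof (rule card_fixed_orbits[OF X])
    show "\<alpha> \<tau> x \<in> X" if \<tau>: "\<tau> permutes {1..m}" and "x \<in> X" for \<tau> x
    proof -
      obtain t f where x: "x = (t, f)" "t \<in> S m" "f \<in> {1..m} \<rightarrow>\<^sub>E A" "?f f = \<mu>"
        using \<open>x \<in> X\<close> by (auto simp: X_def)
      have "(\<Sum>i\<in>{1..m}. wt (f (inv \<tau> i))) = ?f f"
        by (rule sum.reindex_bij_betw[OF permutes_imp_bij[OF permutes_inv[OF \<tau>]]])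
      then show ?thesis
        using x(4) act_closed[OF \<tau> x(2)] comp_inv_PiE[OF x(3) \<tau>]
        by (simp add: x(1) X_def \<alpha>_def)
    qed
    show "\<phi> x \<in> X" if "x \<in> X" for x
    proof -
      obtain t f where x: "x = (t, f)" "t \<in> S m" "f \<in> {1..m} \<rightarrow>\<^sub>E A" "?f f = \<mu>"
        using \<open>x \<in> X\<close> by (auto simp: X_def)
      have f: "f i \<in> A" if "i \<in> {1..m}" for i using PiE_mem[OF x(3) that] .
      have "?f (restrict (h \<circ> f) {1..m}) = ?f f" by (rule sum.cong) (use f wt_h in auto)
      then show ?thesis using x g_closed f h_closed by (auto simp: X_def \<phi>_def)
    qed
    show "\<alpha> (\<tau> \<circ> \<rho>) x = \<alpha> \<tau> (\<alpha> \<rho> x)"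
      if "\<tau> permutes {1..m}" "\<rho> permutes {1..m}" "x \<in> X" for \<tau> \<rho> x
      using that act_comp
      by (auto simp: X_def \<alpha>_def o_inv_distrib permutes_bij comp_assoc)
    show "\<phi> (\<alpha> \<tau> x) = \<alpha> \<tau> (\<phi> x)" if "\<tau> permutes {1..m}" "x \<in> X" for \<tau> x
    proof -
      obtain t f where x: "x = (t, f)" "t \<in> S m" using \<open>x \<in> X\<close> by (auto simp: X_def)
      show ?thesis using g_act[OF that(1) x(2)] restrict_comp_inv[OF that(1), of h f]
        by (simp add: x(1) \<phi>_def \<alpha>_def)
    qed
  qed (auto simp: X_def \<alpha>_def act_id)
  \<comment> \<open>The element \<open>(m, Q)\<close> is fixed by \<open>analytic_map g h\<close>
    precisely if \<phi> maps the orbit \<open>Q\<close> onto itself.\<close>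
  moreover have "card (fixed_of_degree m \<mu>) = card {Q \<in> sym_orbit (act m) m ` X. \<phi> ` Q = Q}"
  proof -
    have "fixed_of_degree m \<mu> = Pair m ` {Q \<in> sym_orbit (act m) m ` X. \<phi> ` Q = Q}"
    proof -
      have map: "analytic_map g h (m, Q) = (m, \<phi> ` Q)" for Q
        by (simp add: analytic_map_def \<phi>_def)
      show ?thesis
      proof (intro equalityI subsetI)
        fix e assume e: "e \<in> fixed_of_degree m \<mu>"
        then obtain t f where x: "e = (m, sym_orbit (act m) m (t, f))" "t \<in> S m" "f \<in> {1..m} \<rightarrow>\<^sub>E A"
          by (auto simp: analytic_set_def)
        with e have "(t, f) \<in> X" by (simp add: X_def analytic_degree_orbit)
        then show "e \<in> Pair m ` {Q \<in> sym_orbit (act m) m ` X. \<phi> ` Q = Q}"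
          using e x(1) map by auto
      next
        fix e assume "e \<in> Pair m ` {Q \<in> sym_orbit (act m) m ` X. \<phi> ` Q = Q}"
        then obtain t f where x: "e = (m, sym_orbit (act m) m (t, f))" "(t, f) \<in> X"
          "\<phi> ` sym_orbit (act m) m (t, f) = sym_orbit (act m) m (t, f)" by auto
        then show "e \<in> fixed_of_degree m \<mu>"
          by (auto simp: X_def analytic_degree_orbit map analytic_set_def)
      qed
    qed
    then show ?thesis by (simp add: card_image inj_on_def)
  qed
  moreover have "card {x \<in> X. \<alpha> \<tau> (\<phi> x) = x} = card {t \<in> S m. act m \<tau> (g m t) = t} *
      card {f \<in> {f \<in> {1..m} \<rightarrow>\<^sub>E A. \<forall>i\<in>{1..m}. f (\<tau> i) = h (f i)}. ?f f = \<mu>}"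
    if \<tau>: "\<tau> permutes {1..m}" for \<tau>
  proof -
    have "{x \<in> X. \<alpha> \<tau> (\<phi> x) = x} = {t \<in> S m. act m \<tau> (g m t) = t} \<times>
      {f \<in> {f \<in> {1..m} \<rightarrow>\<^sub>E A. \<forall>i\<in>{1..m}. f (\<tau> i) = h (f i)}. ?f f = \<mu>}"
      (is "?L = ?R")
    proof (rule set_eqI)
      fix x :: "'s \<times> (nat \<Rightarrow> 'a)"
      obtain t f where x: "x = (t, f)" by (cases x)
      show "x \<in> ?L \<longleftrightarrow> x \<in> ?R"
      proof (cases "f \<in> {1..m} \<rightarrow>\<^sub>E A")
        case True
        then show ?thesis
          using fixed_pair_iff[OF \<tau> True] by (auto simp: x X_def \<alpha>_def \<phi>_def simp del: One_nat_def)
      next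
        case False
        then show ?thesis by (simp add: x X_def)
      qed
    qed
    then show ?thesis by (simp only: card_cartesian_product)
  qed
  moreover have "mps_coeff (\<Prod>k\<in>#cycle_type m \<tau>. cycle_weight k) \<mu> =
      of_nat (card {f \<in> {f \<in> {1..m} \<rightarrow>\<^sub>E A. \<forall>i\<in>{1..m}. f (\<tau> i) = h (f i)}. ?f f = \<mu>})"
    if \<tau>: "\<tau> permutes {1..m}" for \<tau>
    using enumerator_equivariant[where wt = wt and h = h, OF \<tau> fibres h_closed wt_h, symmetric]
    by (simp only: coeff_enumerator)
  ultimately have "of_nat (fact m * card (fixed_of_degree m \<mu>)) =
    (\<Sum>\<tau> | \<tau> permutes {1..m}. of_nat (card {t \<in> S m. act m \<tau> (g m t) = t}) *
      mps_coeff (\<Prod>k\<in>#cycle_type m \<tau>. cycle_weight k) \<mu>)"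
    by simp
  then show ?thesis by simp
qed

end

section \<open>The number of permutations of a given cycle type\<close>

lemma sum_permutations_by_type:
  "(\<Sum>\<tau> | \<tau> permutes {1..m}. a (cycle_type m \<tau>)) =
    (\<Sum>\<nu>\<in>partitions_of m. of_nat (card {\<tau>. \<tau> permutes {1..m} \<and> cycle_type m \<tau> = \<nu>}) * a \<nu>)"
proof -
  have "(\<Sum>\<tau> | \<tau> permutes {1..m}. a (cycle_type m \<tau>)) =
    (\<Sum>\<nu>\<in>partitions_of m. \<Sum>\<tau> | \<tau> \<in> {\<tau>. \<tau> permutes {1..m}} \<and> cycle_type m \<tau> = \<nu>. a (cycle_type m \<tau>))"
    using cycle_type_partition
    by (intro sum.group[symmetric] finite_permutations finite_partitions_of) (auto simp: partitions_of_def)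
  also have "\<dots> = (\<Sum>\<nu>\<in>partitions_of m.
      of_nat (card {\<tau>. \<tau> permutes {1..m} \<and> cycle_type m \<tau> = \<nu>}) * a \<nu>)"
    by (rule sum.cong) auto
  finally show ?thesis .
qed

text \<open>Each of the \<open>m\<close> positions carries one variable, so a monomial determines
  the only \<open>m\<close> that can contribute to its coefficient.\<close>

lemma size_analytic_degree:
  assumes "e \<in> analytic_set S act A"
  shows "size (analytic_degree (\<lambda>i. {#i#}) e) = fst e"
proof -
  obtain m t f where e: "e = (m, sym_orbit (act m) m (t, f))" using assms by (auto simp: analytic_set_def)
  have "size (\<Sum>i\<in>{1..m}. {#f i#}) = m" by (simp add: size_multiset_sum)
  then show ?thesis by (simp add: e analytic_degree_orbit)
qed

lemma finite_fibres_singleton_mset: "finite_fibres UNIV (\<lambda>i. {#i#})"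
proof -
  have "{i. {#i#} = m} \<subseteq> set_mset m" for m :: "'a multiset" by auto
  then have "finite {i. {#i#} = m}" for m :: "'a multiset" by (rule finite_subset) simp
  then show ?thesis by (simp add: finite_fibres_def)
qed

lemma enumerator_repeat_singleton:
  "enumerator {i \<in> UNIV. (id ^^ k) i = i} (\<lambda>i. repeat_mset k {#i#}) = power_sum k"
proof -
  have "repeat_mset k {#i#} = replicate_mset k i" for i :: 'a by (induction k) auto
  then show ?thesis by (simp add: power_sum_eq_enumerator)
qed

text \<open>With one structure for each \<open>m\<close> the orbits are multisets, so every \<mu> of
  size \<open>m\<close> has exactly one. The count says that the sum of \<open>?N \<nu>\<close>
  times \<open>power_sum_part \<nu>\<close> is \<open>fact m\<close> times
  \<open>complete_mps m\<close>; the expansion of the latter and linear independence give the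
  coefficients.\<close>

lemma card_cycle_type:
  assumes "\<nu> \<in> partitions_of m"
  shows "of_nat (card {\<tau>. \<tau> permutes {1..m} \<and> cycle_type m \<tau> = \<nu>}) = (fact m / of_nat (z_part \<nu>) :: rat)"
proof -
  interpret triv: equivariant_family "\<lambda>_. {()}" "\<lambda>_ _ t. t" "\<lambda>_ t. t" "UNIV :: num set" "\<lambda>i. {#i#}" id
    by unfold_locales (auto simp: finite_fibres_singleton_mset)
  let ?act = "\<lambda>_ _ t. t :: unit"
  let ?N = "\<lambda>\<nu>. rat_of_nat (card {\<tau>. \<tau> permutes {1..m} \<and> cycle_type m \<tau> = \<nu>})"
  have img: "(\<Sum>i\<in>{1..m}. {#f i#}) = image_mset f (mset_set {1..m})" for f :: "nat \<Rightarrow> num"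
    by (simp add: sum_unfold_sum_mset)
  have one: "card (triv.fixed_of_degree m \<mu>) = (if size \<mu> = m then 1 else 0)" for \<mu>
  proof (cases "size \<mu> = m")
    case False
    have none: "triv.fixed_of_degree m \<mu> = {}" using False by (auto dest: size_analytic_degree)
    show ?thesis unfolding none using False by simp
  next
    case True
    obtain xs where xs: "mset xs = \<mu>" using ex_mset by blast
    \<comment> \<open>The entries of \<mu>, listed in any order, are the values of \<open>f\<close>;
      positions are counted from 1 and list indices from 0.\<close>
    define f where "f = restrict (\<lambda>i. xs ! (i - 1)) {1..m}"
    have f: "f \<in> {1..m} \<rightarrow>\<^sub>E UNIV" by (simp add: f_def)
    have len: "length xs = m" using xs True by auto
    have "map f [1..<Suc m] = xs"
      by (rule nth_equalityI) (auto simp: f_def len simp del: upt_Suc)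
    then have "image_mset f (mset_set {1..m}) = \<mu>"
      using xs by (metis atLeastLessThanSuc_atLeastAtMost mset_map mset_upt)
    then have f\<mu>: "(\<Sum>i\<in>{1..m}. {#f i#}) = \<mu>" by (simp only: img)
    have "triv.fixed_of_degree m \<mu> = {(m, sym_orbit (?act m) m ((), f))}"
    proof (intro equalityI subsetI)
      fix e assume e: "e \<in> triv.fixed_of_degree m \<mu>"
      then obtain f' where f': "f' \<in> {1..m} \<rightarrow>\<^sub>E UNIV" "e = (m, sym_orbit (?act m) m ((), f'))"
        by (auto simp: analytic_set_def)
      with e have "(\<Sum>i\<in>{1..m}. {#f' i#}) = \<mu>" by (simp add: analytic_degree_orbit)
      \<comment> \<open>Two functions with the same multiset of values differ by a permutation of
        \<open>{1..m}\<close> and hence lie in one orbit.\<close>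
      then have "image_mset f' (mset_set {1..m}) = image_mset f (mset_set {1..m})"
        using f\<mu> by (simp only: img)
      then obtain \<pi> where \<pi>: "\<pi> permutes {1..m}" "\<forall>i\<in>{1..m}. f' i = f (\<pi> i)"
        by (rule image_mset_eq_implies_permutes[OF finite_atLeastAtMost])
      have f'eq: "f' = f \<circ> \<pi>"
      proof
        fix i
        show "f' i = (f \<circ> \<pi>) i"
        proof (cases "i \<in> {1..m}")
          case False
          then show ?thesis
            using permutes_not_in[OF \<pi>(1)] PiE_arb[OF f] PiE_arb[OF f'(1)] by (simp del: atLeastAtMost_iff)
        qed (use \<pi>(2) in simp)
      qed
      have "sym_orbit (?act m) m ((), f') = sym_orbit (?act m) m ((), f)"
      proof (intro equalityI subsetI)
        fix p assume "p \<in> sym_orbit (?act m) m ((), f')"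
        then obtain \<tau> where \<tau>: "\<tau> permutes {1..m}" "p = ((), f' \<circ> inv \<tau>)" by (auto simp: sym_orbit_def)
        have "f' \<circ> inv \<tau> = f \<circ> inv (\<tau> \<circ> inv \<pi>)"
          unfolding o_inv_distrib[OF permutes_bij[OF \<tau>(1)] permutes_bij[OF permutes_inv[OF \<pi>(1)]]]
          by (simp add: f'eq permutes_inv_inv[OF \<pi>(1)] comp_assoc)
        moreover have "\<tau> \<circ> inv \<pi> permutes {1..m}"
          using \<tau>(1) \<pi>(1) by (simp add: permutes_compose permutes_inv)
        ultimately show "p \<in> sym_orbit (?act m) m ((), f)" using \<tau>(2) by (auto simp: sym_orbit_def)
      next
        fix p assume "p \<in> sym_orbit (?act m) m ((), f)"
        then obtain \<tau> where \<tau>: "\<tau> permutes {1..m}" "p = ((), f \<circ> inv \<tau>)" by (auto simp: sym_orbit_def)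
        have "f \<circ> inv \<tau> = f' \<circ> inv (\<tau> \<circ> \<pi>)"
          unfolding o_inv_distrib[OF permutes_bij[OF \<tau>(1)] permutes_bij[OF \<pi>(1)]]
          by (simp add: f'eq fun_eq_iff permutes_inverses[OF \<pi>(1)])
        moreover have "\<tau> \<circ> \<pi> permutes {1..m}"
          using \<tau>(1) \<pi>(1) by (simp add: permutes_compose)
        ultimately show "p \<in> sym_orbit (?act m) m ((), f')" using \<tau>(2) by (auto simp: sym_orbit_def)
      qed
      then show "e \<in> {(m, sym_orbit (?act m) m ((), f))}" using f' by simp
    next
      fix e assume e: "e \<in> {(m, sym_orbit (?act m) m ((), f))}"
      have "restrict (id \<circ> f) {1..m} = f" by (simp add: f_def)
      then show "e \<in> triv.fixed_of_degree m \<mu>"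
        using e f f\<mu> triv.analytic_map_orbit[of "()" m f]
        by (auto simp: analytic_degree_orbit analytic_set_def)
    qed
    with True show ?thesis by simp
  qed
  have "?N \<nu> - fact m / of_nat (z_part \<nu>) = 0"
  proof (rule power_sum_part_independent[OF infinite_UNIV_num finite_partitions_of _ _ assms,
      where c = "\<lambda>\<nu>. ?N \<nu> - fact m / of_nat (z_part \<nu>)"])
    fix \<mu> :: "num multiset"
    have "(\<Sum>\<nu>\<in>partitions_of m. ?N \<nu> * mps_coeff (power_sum_part \<nu>) \<mu>)
        = (\<Sum>\<tau> | \<tau> permutes {1..m}. mps_coeff (power_sum_part (cycle_type m \<tau>)) \<mu>)"
      by (rule sum_permutations_by_type[symmetric])
    also have "\<dots> = fact m * mps_coeff (complete_mps m) \<mu>"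
      using triv.card_fixed_of_degree[of m \<mu>] unfolding one
      by (simp add: coeff_complete enumerator_repeat_singleton[simplified] split: if_splits
          flip: power_sum_part_def)
    also have "\<dots> = (\<Sum>\<nu>\<in>partitions_of m. fact m / of_nat (z_part \<nu>) * mps_coeff (power_sum_part \<nu>) \<mu>)"
      by (simp add: complete_eq_sum_power_sum_part sum_distrib_left)
    finally show "(\<Sum>\<nu>\<in>partitions_of m. (?N \<nu> - fact m / of_nat (z_part \<nu>)) *
        mps_coeff (power_sum_part \<nu>) \<mu>) = 0"
      by (simp add: left_diff_distrib sum_subtractf)
  qed (auto simp: partitions_of_def)
  then show ?thesis by simp
qed

section \<open>Fixed elements counted by cycle type\<close>

context equivariant_family
begin

text \<open>The permutations are grouped by cycle type, and \<open>fact m\<close> cancels against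
  the class size \<open>fact m / z_part \<nu>\<close>.\<close>

lemma card_fixed_of_degree_by_type:
  assumes fixc: "\<And>\<tau>. \<tau> permutes {1..m} \<Longrightarrow> card {t \<in> S m. act m \<tau> (g m t) = t} = c (cycle_type m \<tau>)"
  shows "of_nat (card (fixed_of_degree m \<mu>)) =
    (\<Sum>\<nu>\<in>partitions_of m. of_nat (c \<nu>) / of_nat (z_part \<nu>) * mps_coeff (\<Prod>k\<in>#\<nu>. cycle_weight k) \<mu>)"
proof -
  have "fact m * rat_of_nat (card (fixed_of_degree m \<mu>)) =
    (\<Sum>\<tau> | \<tau> permutes {1..m}. of_nat (c (cycle_type m \<tau>)) *
      mps_coeff (\<Prod>k\<in>#cycle_type m \<tau>. cycle_weight k) \<mu>)"
    unfolding card_fixed_of_degree by (intro sum.cong refl) (simp add: fixc)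
  also have "\<dots> = (\<Sum>\<nu>\<in>partitions_of m. fact m / of_nat (z_part \<nu>) *
      (of_nat (c \<nu>) * mps_coeff (\<Prod>k\<in>#\<nu>. cycle_weight k) \<mu>))"
    by (subst sum_permutations_by_type) (simp add: card_cycle_type del: One_nat_def)
  also have "\<dots> = fact m * (\<Sum>\<nu>\<in>partitions_of m. of_nat (c \<nu>) / of_nat (z_part \<nu>) *
      mps_coeff (\<Prod>k\<in>#\<nu>. cycle_weight k) \<mu>)"
    by (simp add: sum_distrib_left)
  finally show ?thesis by simp
qed

lemma finite_of_degree: "finite {e \<in> analytic_set S act A. fst e = m \<and> analytic_degree wt e = \<mu>}"
proof -
  let ?X = "S m \<times> {f \<in> {1..m} \<rightarrow>\<^sub>E A. (\<Sum>i\<in>{1..m}. wt (f i)) = \<mu>}"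
  have "finite ?X"
    using finite_fibres_PiE[where I = "{1..m}" and E = "\<lambda>_. A" and wt = "\<lambda>_. wt"] fibres finite_S
    by (simp add: finite_fibres_def)
  moreover have "{e \<in> analytic_set S act A. fst e = m \<and> analytic_degree wt e = \<mu>}
      \<subseteq> (\<lambda>x. (m, sym_orbit (act m) m x)) ` ?X"
    by (auto simp: analytic_set_def analytic_degree_orbit)
  ultimately show ?thesis by (blast intro: finite_subset)
qed

end

section \<open>Species\<close>

lemma species_permutation:
  assumes "is_species F"
  shows "finite (Struct F {1..m})"
    and "\<tau> permutes {1..m} \<Longrightarrow> bij_betw (Transp F {1..m} \<tau>) (Struct F {1..m}) (Struct F {1..m})"
    and "t \<in> Struct F {1..m} \<Longrightarrow> Transp F {1..m} id t = t"
    and "\<tau> permutes {1..m} \<Longrightarrow> \<rho> permutes {1..m} \<Longrightarrow> t \<in> Struct F {1..m} \<Longrightarrow>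
      Transp F {1..m} (\<tau> \<circ> \<rho>) t = Transp F {1..m} \<tau> (Transp F {1..m} \<rho> t)"
  using assms permutes_imp_bij finite_atLeastAtMost unfolding is_species_def by metis+

lemma species2_permutation:
  assumes "is_species2 G"
  shows "finite (Struct2 G {1..m} {1..n})"
    and "\<tau> permutes {1..m} \<Longrightarrow> \<sigma> permutes {1..n} \<Longrightarrow>
      bij_betw (Transp2 G {1..m} {1..n} \<tau> \<sigma>) (Struct2 G {1..m} {1..n}) (Struct2 G {1..m} {1..n})"
    and "t \<in> Struct2 G {1..m} {1..n} \<Longrightarrow> Transp2 G {1..m} {1..n} id id t = t"
    and "\<tau> permutes {1..m} \<Longrightarrow> \<rho> permutes {1..m} \<Longrightarrow> \<sigma> permutes {1..n} \<Longrightarrow> \<pi> permutes {1..n} \<Longrightarrow>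
      t \<in> Struct2 G {1..m} {1..n} \<Longrightarrow>
      Transp2 G {1..m} {1..n} \<tau> \<sigma> (Transp2 G {1..m} {1..n} \<rho> \<pi> t) = Transp2 G {1..m} {1..n} (\<tau> \<circ> \<rho>) (\<sigma> \<circ> \<pi>) t"
proof -
  note G = assms[unfolded is_species2_def]
  show "finite (Struct2 G {1..m} {1..n})"
    using conjunct1[OF G, rule_format, of "{1..m}" "{1..n}"] by simp
  show "Transp2 G {1..m} {1..n} id id t = t" if "t \<in> Struct2 G {1..m} {1..n}"
    using conjunct1[OF conjunct2[OF conjunct2[OF conjunct2[OF G]]], rule_format,
        of "{1..m}" "{1..n}" t] that by simp
  show "bij_betw (Transp2 G {1..m} {1..n} \<tau> \<sigma>) (Struct2 G {1..m} {1..n}) (Struct2 G {1..m} {1..n})"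
    if "\<tau> permutes {1..m}" "\<sigma> permutes {1..n}"
    using conjunct1[OF conjunct2[OF G], rule_format, of "{1..m}" "{1..n}" \<tau> "{1..m}" \<sigma> "{1..n}"]
      that[THEN permutes_imp_bij] by simp
  show "Transp2 G {1..m} {1..n} \<tau> \<sigma> (Transp2 G {1..m} {1..n} \<rho> \<pi> t) = Transp2 G {1..m} {1..n} (\<tau> \<circ> \<rho>) (\<sigma> \<circ> \<pi>) t"
    if "\<tau> permutes {1..m}" "\<rho> permutes {1..m}" "\<sigma> permutes {1..n}" "\<pi> permutes {1..n}"
      "t \<in> Struct2 G {1..m} {1..n}"
    using conjunct2[OF conjunct2[OF conjunct2[OF conjunct2[OF G]]], rule_format,
        of "{1..m}" "{1..n}" \<rho> "{1..m}" \<tau> "{1..m}" \<pi> "{1..n}" \<sigma> "{1..n}" t]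
      that(1-4)[THEN permutes_imp_bij] that(5) by simp
qed

section \<open>Numbers of fixed structures depend only on the cycle type\<close>

lemma card_fixed_conj:
  assumes "bij_betw p Y Y" and "\<And>s. s \<in> Y \<Longrightarrow> a s \<in> Y" and "\<And>s. s \<in> Y \<Longrightarrow> p (a s) = b (p s)"
  shows "card {s \<in> Y. a s = s} = card {s \<in> Y. b s = s}"
proof (rule bij_betw_same_card)
  have inj: "inj_on p Y" and img: "p ` Y = Y" using assms(1) by (auto simp: bij_betw_def)
  have iff: "b (p s) = p s \<longleftrightarrow> a s = s" if "s \<in> Y" for s
    using assms(2)[OF that] assms(3)[OF that, symmetric] inj_on_eq_iff[OF inj] that by simp
  have "p ` {s \<in> Y. a s = s} = {s \<in> Y. b s = s}"
  proof (intro equalityI subsetI)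
    fix s assume s: "s \<in> {s \<in> Y. b s = s}"
    then obtain u where "u \<in> Y" "s = p u" using img by blast
    with s iff show "s \<in> p ` {s \<in> Y. a s = s}" by auto
  qed (use iff img in auto)
  then show "bij_betw p {s \<in> Y. a s = s} {s \<in> Y. b s = s}"
    using inj by (auto simp: bij_betw_def intro: inj_on_subset)
qed

text \<open>\<tau> itself shows that a permutation of its cycle type exists, so the choice in
  \<open>perm_of_type\<close> has the intended properties and is conjugate to \<tau>.\<close>

lemma perm_of_type_conj:
  assumes "\<tau> permutes {1..m}"
  obtains \<pi> where "\<pi> permutes {1..m}" "perm_of_type (cycle_type m \<tau>) permutes {1..m}"
    "\<pi> \<circ> perm_of_type (cycle_type m \<tau>) = \<tau> \<circ> \<pi>"
proof -
  let ?\<rho> = "perm_of_type (cycle_type m \<tau>)"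
  have "?\<rho> permutes {1..m} \<and> cycle_type m ?\<rho> = cycle_type m \<tau>"
    unfolding perm_of_type_def cycle_type_partition(2)[OF assms] by (rule someI[of _ \<tau>]) (use assms in simp)
  then show ?thesis using cycle_type_eq_imp_conj[of ?\<rho> m \<tau>] assms that by blast
qed

lemma card_fixed_species:
  assumes F: "is_species F" and \<tau>: "\<tau> permutes {1..m}"
  shows "card {t \<in> Struct F {1..m}. Transp F {1..m} \<tau> t = t} = fix_count F (cycle_type m \<tau>)"
proof -
  obtain \<pi> where \<pi>: "\<pi> permutes {1..m}" "perm_of_type (cycle_type m \<tau>) permutes {1..m}"
    "\<pi> \<circ> perm_of_type (cycle_type m \<tau>) = \<tau> \<circ> \<pi>" by (rule perm_of_type_conj[OF \<tau>])
  show ?thesis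
    unfolding fix_count_def cycle_type_partition(2)[OF \<tau>]
  proof (rule card_fixed_conj[symmetric, OF species_permutation(2)[OF F \<pi>(1)]])
    fix s assume s: "s \<in> Struct F {1..m}"
    show "Transp F {1..m} (perm_of_type (cycle_type m \<tau>)) s \<in> Struct F {1..m}"
      using bij_betwE[OF species_permutation(2)[OF F \<pi>(2)]] s by blast
    show "Transp F {1..m} \<pi> (Transp F {1..m} (perm_of_type (cycle_type m \<tau>)) s)
        = Transp F {1..m} \<tau> (Transp F {1..m} \<pi> s)"
      using species_permutation(4)[OF F \<pi>(1) \<pi>(2) s] species_permutation(4)[OF F \<tau> \<pi>(1) s] \<pi>(3) by simp
  qed
qed

lemma card_fixed_species2:
  assumes G: "is_species2 G" and \<tau>: "\<tau> permutes {1..m}" and \<sigma>: "\<sigma> permutes {1..n}"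
  shows "card {t \<in> Struct2 G {1..m} {1..n}. Transp2 G {1..m} {1..n} \<tau> \<sigma> t = t}
    = fix_count2 G (cycle_type m \<tau>) (cycle_type n \<sigma>)"
proof -
  obtain \<pi> where \<pi>: "\<pi> permutes {1..m}" "perm_of_type (cycle_type m \<tau>) permutes {1..m}"
    "\<pi> \<circ> perm_of_type (cycle_type m \<tau>) = \<tau> \<circ> \<pi>" by (rule perm_of_type_conj[OF \<tau>])
  obtain \<rho> where \<rho>: "\<rho> permutes {1..n}" "perm_of_type (cycle_type n \<sigma>) permutes {1..n}"
    "\<rho> \<circ> perm_of_type (cycle_type n \<sigma>) = \<sigma> \<circ> \<rho>" by (rule perm_of_type_conj[OF \<sigma>])
  show ?thesis
    unfolding fix_count2_def cycle_type_partition(2)[OF \<tau>] cycle_type_partition(2)[OF \<sigma>]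
  proof (rule card_fixed_conj[symmetric, OF species2_permutation(2)[OF G \<pi>(1) \<rho>(1)]])
    fix s assume s: "s \<in> Struct2 G {1..m} {1..n}"
    show "Transp2 G {1..m} {1..n} (perm_of_type (cycle_type m \<tau>)) (perm_of_type (cycle_type n \<sigma>)) s
        \<in> Struct2 G {1..m} {1..n}"
      using bij_betwE[OF species2_permutation(2)[OF G \<pi>(2) \<rho>(2)]] s by blast
    show "Transp2 G {1..m} {1..n} \<pi> \<rho>
          (Transp2 G {1..m} {1..n} (perm_of_type (cycle_type m \<tau>)) (perm_of_type (cycle_type n \<sigma>)) s)
        = Transp2 G {1..m} {1..n} \<tau> \<sigma> (Transp2 G {1..m} {1..n} \<pi> \<rho> s)"
      using species2_permutation(4)[OF G \<pi>(1) \<pi>(2) \<rho>(1) \<rho>(2) s]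
        species2_permutation(4)[OF G \<tau> \<pi>(1) \<sigma> \<rho>(1) s] \<pi>(3) \<rho>(3) by simp
  qed
qed

text \<open>The symmetric group acts on the first argument and \<sigma> on the second; by
  functoriality both composites are transport along \<open>(\<tau>, \<sigma>)\<close>, so the
  actions commute.\<close>

lemma equivariant_family_species2:
  assumes G: "is_species2 G" and \<sigma>: "\<sigma> permutes {1..n}"
  shows "equivariant_family (\<lambda>m. Struct2 G {1..m} {1..n}) (\<lambda>m \<tau>. Transp2 G {1..m} {1..n} \<tau> id)
    (\<lambda>m. Transp2 G {1..m} {1..n} id \<sigma>) UNIV (\<lambda>i. {#i#}) id"
proof
  fix m \<tau> t
  note perm = species2_permutation[OF G, where m = m and n = n]
  show "finite (Struct2 G {1..m} {1..n})" by (rule perm(1))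
  assume t: "t \<in> Struct2 G {1..m} {1..n}"
  show "Transp2 G {1..m} {1..n} id id t = t" using perm(3)[OF t] .
  show "Transp2 G {1..m} {1..n} id \<sigma> t \<in> Struct2 G {1..m} {1..n}"
    using bij_betwE[OF perm(2)[OF permutes_id \<sigma>]] t by blast
  assume \<tau>: "\<tau> permutes {1..m}"
  show "Transp2 G {1..m} {1..n} \<tau> id t \<in> Struct2 G {1..m} {1..n}"
    using bij_betwE[OF perm(2)[OF \<tau> permutes_id]] t by blast
  show "Transp2 G {1..m} {1..n} id \<sigma> (Transp2 G {1..m} {1..n} \<tau> id t)
      = Transp2 G {1..m} {1..n} \<tau> id (Transp2 G {1..m} {1..n} id \<sigma> t)"
    using perm(4)[OF permutes_id \<tau> \<sigma> permutes_id t] perm(4)[OF \<tau> permutes_id permutes_id \<sigma> t] by simp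
  fix \<rho> assume \<rho>: "\<rho> permutes {1..m}"
  show "Transp2 G {1..m} {1..n} (\<tau> \<circ> \<rho>) id t
      = Transp2 G {1..m} {1..n} \<tau> id (Transp2 G {1..m} {1..n} \<rho> id t)"
    using perm(4)[OF \<tau> \<rho> permutes_id permutes_id t] by simp
qed (simp_all add: finite_fibres_singleton_mset)

section \<open>The series chi and its expansion in power sums\<close>

lemma analytic_weight_var:
  "analytic_weight (mps_var :: 'v \<Rightarrow> 'v mps) = (\<lambda>e. mps_monom (analytic_degree (\<lambda>i. {#i#}) e))"
proof -
  have "analytic_weight (mps_var :: 'v \<Rightarrow> 'v mps) = analytic_weight (\<lambda>i. mps_monom {#i#})"
    by (rule arg_cong[where f = analytic_weight]) (simp add: fun_eq_iff mps_var_eq_monom)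
  also have "\<dots> = (\<lambda>e. mps_monom (analytic_degree (\<lambda>i. {#i#}) e))"
    by (rule analytic_weight_monom)
  finally show ?thesis .
qed

lemma fix_weight_eq_enumerator:
  "fix_weight G n \<sigma> = enumerator {e \<in> species2_app G UNIV {1..n}. species2_app_map G {1..n} id \<sigma> e = e}
     (analytic_degree (\<lambda>i. {#i#}))"
  by (simp add: fix_weight_def enumerator_def analytic_weight_var)

text \<open>Only \<open>m = size \<mu>\<close> contributes at \<mu>. Acting by \<sigma> and then by
  \<tau> is transport along both, whose fixed structures \<open>fix_count2\<close> counts, and with
  \<open>h = id\<close> each cycle of length \<open>k\<close> gives
  \<open>power_sum k\<close>.\<close>

lemma fix_weight_eq_sum:
  assumes G: "is_species2 G" and \<sigma>: "\<sigma> permutes {1..n}"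
  shows "fix_weight G n \<sigma> = mps_sum partitions
    (\<lambda>\<nu>. mps_const (of_nat (fix_count2 G \<nu> (cycle_type n \<sigma>)) / of_nat (z_part \<nu>)) * power_sum_part \<nu>)"
proof (rule mps_eqI)
  fix \<mu>
  interpret equivariant_family "\<lambda>m. Struct2 G {1..m} {1..n}" "\<lambda>m \<tau>. Transp2 G {1..m} {1..n} \<tau> id"
    "\<lambda>m. Transp2 G {1..m} {1..n} id \<sigma>" "UNIV :: num set" "\<lambda>i. {#i#}" id
    by (rule equivariant_family_species2[OF G \<sigma>])
  have "mps_coeff (fix_weight G n \<sigma>) \<mu> = of_nat (card (fixed_of_degree (size \<mu>) \<mu>))"
    unfolding fix_weight_eq_enumerator coeff_enumerator species2_app_def species2_app_map_def
    by (rule arg_cong[where f = "\<lambda>S. of_nat (card S)"]) (auto dest: size_analytic_degree)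
  also have "\<dots> = (\<Sum>\<nu>\<in>partitions_of (size \<mu>). of_nat (fix_count2 G \<nu> (cycle_type n \<sigma>)) / of_nat (z_part \<nu>) *
      mps_coeff (\<Prod>k\<in>#\<nu>. cycle_weight k) \<mu>)"
  proof (rule card_fixed_of_degree_by_type)
    fix \<tau> :: "nat \<Rightarrow> nat" assume \<tau>: "\<tau> permutes {1..size \<mu>}"
    have "{t \<in> Struct2 G {1..size \<mu>} {1..n}.
        Transp2 G {1..size \<mu>} {1..n} \<tau> id (Transp2 G {1..size \<mu>} {1..n} id \<sigma> t) = t}
      = {t \<in> Struct2 G {1..size \<mu>} {1..n}. Transp2 G {1..size \<mu>} {1..n} \<tau> \<sigma> t = t}"
      using species2_permutation(4)[OF G \<tau> permutes_id permutes_id \<sigma>] by (intro Collect_cong) auto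
    then show "card {t \<in> Struct2 G {1..size \<mu>} {1..n}.
        Transp2 G {1..size \<mu>} {1..n} \<tau> id (Transp2 G {1..size \<mu>} {1..n} id \<sigma> t) = t}
      = fix_count2 G (cycle_type (size \<mu>) \<tau>) (cycle_type n \<sigma>)"
      by (simp only: card_fixed_species2[OF G \<tau> \<sigma>])
  qed
  also have "\<dots> = (\<Sum>\<nu>\<in>partitions_of (size \<mu>). mps_coeff
      (mps_const (of_nat (fix_count2 G \<nu> (cycle_type n \<sigma>)) / of_nat (z_part \<nu>)) * power_sum_part \<nu>) \<mu>)"
    unfolding enumerator_repeat_singleton power_sum_part_def by simp
  \<comment> \<open>By homogeneity the partitions of other numbers contribute nothing at
    \<mu>.\<close>
  also have "\<dots> = mps_coeff (mps_sum partitions (\<lambda>\<nu>.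
      mps_const (of_nat (fix_count2 G \<nu> (cycle_type n \<sigma>)) / of_nat (z_part \<nu>)) * power_sum_part \<nu>)) \<mu>"
    by (rule coeff_mps_sum_finite[symmetric, OF finite_partitions_of])
      (auto simp: partitions_of_def dest: coeff_power_sum_part_size)
  finally show "mps_coeff (fix_weight G n \<sigma>) \<mu> = \<dots>" .
qed

section \<open>Symmetry and invariance under conjugation\<close>

lemma mps_symmetric_one: "mps_symmetric 1"
  by (auto simp: mps_symmetric_def coeff_one)

text \<open>Renaming the variables by \<pi> is a bijection between the splittings of
  \<open>m\<close> and those of \<open>image_mset \<pi> m\<close>.\<close>

lemma mps_symmetric_times:
  assumes "mps_symmetric f" "mps_symmetric g"
  shows "mps_symmetric (f * g)"
  unfolding mps_symmetric_def
proof (intro allI impI)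
  fix \<pi> :: "'a \<Rightarrow> 'a" and m assume \<pi>: "bij \<pi>"
  have inv: "image_mset (inv \<pi>) (image_mset \<pi> a) = a" "image_mset \<pi> (image_mset (inv \<pi>) a) = a" for a
    using \<pi> by (simp_all add: image_mset.compositionality comp_def bij_is_inj bij_is_surj surj_f_inv_f)
  have "(\<Sum>(a, b) | a + b = image_mset \<pi> m. mps_coeff f a * mps_coeff g b)
      = (\<Sum>(a, b) | a + b = m. mps_coeff f a * mps_coeff g b)"
  proof (rule sum.reindex_bij_witness[of _ "\<lambda>(a, b). (image_mset \<pi> a, image_mset \<pi> b)"
        "\<lambda>(a, b). (image_mset (inv \<pi>) a, image_mset (inv \<pi>) b)"])
    fix p assume "p \<in> {(a, b). a + b = image_mset \<pi> m}"
    then obtain a b where p: "p = (a, b)" "a + b = image_mset \<pi> m" by blast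
    have "image_mset (inv \<pi>) a + image_mset (inv \<pi>) b = m"
      unfolding image_mset_union[symmetric] p(2) by (rule inv)
    then show "(case p of (a, b) \<Rightarrow> (image_mset (inv \<pi>) a, image_mset (inv \<pi>) b)) \<in> {(a, b). a + b = m}"
      by (simp add: p)
    have "mps_coeff f (image_mset (inv \<pi>) a) = mps_coeff f a" "mps_coeff g (image_mset (inv \<pi>) b) = mps_coeff g b"
      using assms \<pi> bij_imp_bij_inv by (auto simp: mps_symmetric_def)
    then show "(case case p of (a, b) \<Rightarrow> (image_mset (inv \<pi>) a, image_mset (inv \<pi>) b) of
        (a, b) \<Rightarrow> mps_coeff f a * mps_coeff g b) = (case p of (a, b) \<Rightarrow> mps_coeff f a * mps_coeff g b)"
      by (simp add: p)
  qed (auto simp: inv)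
  then show "mps_coeff (f * g) (image_mset \<pi> m) = mps_coeff (f * g) m" by (simp add: coeff_times)
qed

lemma mps_symmetric_power_sum: "mps_symmetric (power_sum k)"
  unfolding mps_symmetric_def
proof (intro allI impI)
  fix \<pi> :: "'a \<Rightarrow> 'a" and m assume \<pi>: "bij \<pi>"
  have "bij_betw \<pi> {i \<in> UNIV. replicate_mset k i = m} {i \<in> UNIV. replicate_mset k i = image_mset \<pi> m}"
  proof (rule bij_betw_byWitness[where f' = "inv \<pi>"])
    show "\<pi> ` {i \<in> UNIV. replicate_mset k i = m} \<subseteq> {i \<in> UNIV. replicate_mset k i = image_mset \<pi> m}"
      by auto
    show "inv \<pi> ` {i \<in> UNIV. replicate_mset k i = image_mset \<pi> m} \<subseteq> {i \<in> UNIV. replicate_mset k i = m}"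
    proof (rule image_subsetI)
      fix i assume i: "i \<in> {i \<in> UNIV. replicate_mset k i = image_mset \<pi> m}"
      then have "image_mset (inv \<pi>) (replicate_mset k i) = image_mset (inv \<pi>) (image_mset \<pi> m)" by simp
      then show "inv \<pi> i \<in> {i \<in> UNIV. replicate_mset k i = m}"
        using \<pi> by (simp add: image_mset.compositionality bij_is_inj)
    qed
  qed (use \<pi> in \<open>auto simp: bij_is_inj bij_is_surj surj_f_inv_f\<close>)
  then show "mps_coeff (power_sum k) (image_mset \<pi> m) = mps_coeff (power_sum k) m"
    unfolding power_sum_eq_enumerator coeff_enumerator by (simp add: bij_betw_same_card)
qed

lemma mps_symmetric_power_sum_part: "mps_symmetric (power_sum_part \<nu>)"
  by (induction \<nu>)
    (auto simp: power_sum_part_add intro: mps_symmetric_one mps_symmetric_times mps_symmetric_power_sum)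

lemma mps_symmetric_mps_sum:
  assumes "\<And>a. a \<in> A \<Longrightarrow> mps_symmetric (w a)"
  shows "mps_symmetric (mps_sum A w)"
  using assms by (auto simp: mps_symmetric_def coeff_mps_sum intro!: sum.cong)

text \<open>Both properties are read off the expansion: its terms are symmetric, and its
  coefficients see \<sigma> only through the cycle type.\<close>

lemma class_function_fix_weight:
  assumes G: "is_species2 G" and \<chi>: "\<And>\<sigma>. \<sigma> permutes {1..n} \<Longrightarrow> \<chi> \<sigma> = fix_weight G n \<sigma>"
  shows "class_function n \<chi>"
  unfolding class_function_def
proof (intro conjI allI impI)
  fix \<sigma> assume \<sigma>: "\<sigma> permutes {1..n}"
  have "mps_symmetric (mps_const c * power_sum_part \<nu> :: num mps)" for c \<nu>
    using mps_symmetric_power_sum_part[of \<nu>] by (auto simp: mps_symmetric_def)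
  then show "mps_symmetric (\<chi> \<sigma>)"
    unfolding \<chi>[OF \<sigma>] fix_weight_eq_sum[OF G \<sigma>] by (intro mps_symmetric_mps_sum)
next
  fix \<sigma> \<pi> assume "\<sigma> permutes {1..n} \<and> \<pi> permutes {1..n}"
  then have \<sigma>: "\<sigma> permutes {1..n}" and \<pi>: "\<pi> permutes {1..n}" by auto
  then have conj: "\<pi> \<circ> \<sigma> \<circ> inv \<pi> permutes {1..n}" by (intro permutes_compose permutes_inv)
  show "\<chi> (\<pi> \<circ> \<sigma> \<circ> inv \<pi>) = \<chi> \<sigma>"
    unfolding \<chi>[OF \<sigma>] \<chi>[OF conj] fix_weight_eq_sum[OF G \<sigma>] fix_weight_eq_sum[OF G conj]
      cycle_type_conj[OF \<sigma> \<pi>] ..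
qed

section \<open>Inner plethysm\<close>

lemma coeff_poly_subst:
  assumes "finite K" "Poly_Mapping.keys P \<subseteq> K"
  shows "mps_coeff (poly_subst P v) \<mu> =
    (\<Sum>\<nu>\<in>K. Poly_Mapping.lookup P \<nu> * mps_coeff (\<Prod>k\<in>#\<nu>. v k) \<mu>)"
  unfolding poly_subst_def coeff_sum coeff_const_times
  by (rule sum.mono_neutral_left) (use assms in \<open>auto simp: in_keys_iff\<close>)

text \<open>Two polynomials with the same value at the power sums agree by linear independence of
  the products of power sums, so the description by \<open>THE\<close> has only one
  solution.\<close>

lemma power_sum_poly_eqI:
  assumes P: "Poly_Mapping.keys P \<subseteq> partitions" "poly_subst P power_sum = f"
  shows "power_sum_poly f = P"
  unfolding power_sum_poly_def
proof (rule the_equality)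
  fix Q assume Q: "Poly_Mapping.keys Q \<subseteq> partitions \<and> poly_subst Q power_sum = f"
  let ?K = "Poly_Mapping.keys P \<union> Poly_Mapping.keys Q"
  have "Poly_Mapping.lookup Q \<nu> - Poly_Mapping.lookup P \<nu> = 0" if "\<nu> \<in> ?K" for \<nu>
  proof (rule power_sum_part_independent[OF infinite_UNIV_num _ _ _ that,
        where c = "\<lambda>\<nu>. Poly_Mapping.lookup Q \<nu> - Poly_Mapping.lookup P \<nu>"])
    fix \<mu> :: "num multiset"
    have "mps_coeff (poly_subst Q power_sum) \<mu> = mps_coeff (poly_subst P power_sum) \<mu>"
      using P Q by simp
    then show "(\<Sum>\<nu>\<in>?K. (Poly_Mapping.lookup Q \<nu> - Poly_Mapping.lookup P \<nu>) *
        mps_coeff (power_sum_part \<nu>) \<mu>) = 0"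
      by (simp add: coeff_poly_subst[of ?K] power_sum_part_def left_diff_distrib sum_subtractf)
  qed (use P Q in auto)
  then show "Q = P" by (intro poly_mapping_eqI) (metis UnCI eq_iff_diff_eq_0 in_keys_iff)
qed (use P in simp)

text \<open>Functoriality in the second argument. It lets the factor of a cycle of length
  \<open>k\<close> be read as the series of \<open>\<sigma> ^^ k\<close>, the argument of \<chi> in
  the Adams operation.\<close>

lemma funpow_species2_app_map:
  assumes G: "is_species2 G" and \<sigma>: "\<sigma> permutes {1..n}" and e: "e \<in> species2_app G UNIV {1..n}"
  shows "(species2_app_map G {1..n} id \<sigma> ^^ k) e = species2_app_map G {1..n} id (\<sigma> ^^ k) (e :: ('s, num) analytic)"
proof -
  interpret equivariant_family "\<lambda>m. Struct2 G {1..m} {1..n}" "\<lambda>m \<tau>. Transp2 G {1..m} {1..n} \<tau> id"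
    "\<lambda>m. Transp2 G {1..m} {1..n} id \<sigma>" "UNIV :: num set" "\<lambda>i. {#i#}" id
    by (rule equivariant_family_species2[OF G \<sigma>])
  obtain m Q where mQ: "e = (m, Q)" by (cases e)
  have Q: "t \<in> Struct2 G {1..m} {1..n} \<and> f \<in> {1..m} \<rightarrow>\<^sub>E UNIV" if "(t, f) \<in> Q" for t f
    using orbit_subset_carrier[of m Q] e that unfolding mQ species2_app_def by blast
  \<comment> \<open>The map on values is the identity, and restricting the already extensional
    \<open>f\<close> changes nothing.\<close>
  have map: "species2_app_map G {1..n} id (\<sigma> ^^ k) e = (m, (\<lambda>(t, f). (Transp2 G {1..m} {1..n} id (\<sigma> ^^ k) t, f)) ` Q)" for k
  proof -
    have "restrict f {1..m} = f" if "(t, f) \<in> Q" for t f using Q[OF that] by (auto simp: PiE_def extensional_restrict)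
    then show ?thesis unfolding mQ species2_app_map_def analytic_map_def by (auto intro!: image_cong)
  qed
  have \<sigma>k: "\<sigma> ^^ k permutes {1..n}" for k by (rule permutes_funpow[OF \<sigma>])
  show ?thesis
  proof (induction k)
    case 0
    have "(\<lambda>(t, f). (Transp2 G {1..m} {1..n} id id t, f)) ` Q = (\<lambda>p. p) ` Q"
      by (rule image_cong) (use species2_permutation(3)[OF G] Q in auto)
    then have "species2_app_map G {1..n} id (\<sigma> ^^ 0) e = e" unfolding map by (simp add: mQ)
    with funpow_0 show ?case by (rule trans[OF _ sym])
  next
    case (Suc k)
    let ?T = "\<lambda>\<rho>. \<lambda>(t, f :: nat \<Rightarrow> num). (Transp2 G {1..m} {1..n} id \<rho> t, f)"
    have "(species2_app_map G {1..n} id \<sigma> ^^ Suc k) e = species2_app_map G {1..n} id \<sigma> (m, ?T (\<sigma> ^^ k) ` Q)"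
      by (simp only: funpow.simps comp_def Suc map)
    also have "\<dots> = (m, (\<lambda>(t, f). (Transp2 G {1..m} {1..n} id \<sigma> t, restrict f {1..m})) ` ?T (\<sigma> ^^ k) ` Q)"
      by (simp add: species2_app_map_def analytic_map_def)
    also have "\<dots> = (m, ?T (\<sigma> ^^ Suc k) ` Q)"
    proof -
      have "(\<lambda>(t, f). (Transp2 G {1..m} {1..n} id \<sigma> t, restrict f {1..m})) ` ?T (\<sigma> ^^ k) ` Q
          = (\<lambda>p. (\<lambda>(t, f). (Transp2 G {1..m} {1..n} id \<sigma> t, restrict f {1..m})) (?T (\<sigma> ^^ k) p)) ` Q"
        by (rule image_image)
      also have "\<dots> = ?T (\<sigma> ^^ Suc k) ` Q"
      proof (rule image_cong[OF refl])
        fix p assume p: "p \<in> Q"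
        obtain t f where tf: "p = (t, f)" by (cases p)
        have "t \<in> Struct2 G {1..m} {1..n}" "restrict f {1..m} = f"
          using Q p tf by (auto simp: PiE_def extensional_restrict)
        then show "(\<lambda>(t, f). (Transp2 G {1..m} {1..n} id \<sigma> t, restrict f {1..m})) (?T (\<sigma> ^^ k) p) = ?T (\<sigma> ^^ Suc k) p"
          using species2_permutation(4)[OF G permutes_id permutes_id \<sigma> \<sigma>k, of t m k] by (simp add: tf)
      qed
      finally show ?thesis by simp
    qed
    finally show ?case by (simp only: map)
  qed
qed

text \<open>Here \<sigma> acts on the values, which are elements of G(P_x, [n]), and leaves the
  structures of \<open>F\<close> alone.\<close>

lemma equivariant_family_species:
  assumes F: "is_species F" and G: "is_species2 G" and \<sigma>: "\<sigma> permutes {1..n}"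
  shows "equivariant_family (\<lambda>m. Struct F {1..m}) (\<lambda>m. Transp F {1..m}) (\<lambda>_ t. t)
    (species2_app G (UNIV :: num set) {1..n}) (analytic_degree (\<lambda>i. {#i#})) (species2_app_map G {1..n} id \<sigma>)"
proof -
  interpret G: equivariant_family "\<lambda>m. Struct2 G {1..m} {1..n}" "\<lambda>m \<tau>. Transp2 G {1..m} {1..n} \<tau> id"
    "\<lambda>m. Transp2 G {1..m} {1..n} id \<sigma>" "UNIV :: num set" "\<lambda>i. {#i#}" id
    by (rule equivariant_family_species2[OF G \<sigma>])
  let ?A = "species2_app G (UNIV :: num set) {1..n}" and ?wt = "analytic_degree (\<lambda>i :: num. {#i#})"
  \<comment> \<open>The degree of an element fixes its \<open>m\<close>, and for one
    \<open>m\<close> there are finitely many elements of a given degree.\<close>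
  have "{e \<in> ?A. ?wt e = \<mu>} = {e \<in> ?A. fst e = size \<mu> \<and> ?wt e = \<mu>}" for \<mu>
    by (auto simp: species2_app_def dest: size_analytic_degree)
  then have fib: "finite_fibres ?A ?wt"
    using G.finite_of_degree unfolding finite_fibres_def species2_app_def by simp
  note perm = species_permutation[OF F]
  show ?thesis
  proof
    fix m \<tau> t assume t: "t \<in> Struct F {1..m}" and \<tau>: "\<tau> permutes {1..m}"
    show "Transp F {1..m} \<tau> t \<in> Struct F {1..m}" using bij_betwE[OF perm(2)[OF \<tau>]] t by blast
  next
    fix e assume "e \<in> ?A"
    then show "species2_app_map G {1..n} id \<sigma> e \<in> ?A" "?wt (species2_app_map G {1..n} id \<sigma> e) = ?wt e"
      unfolding species2_app_def species2_app_map_def by (rule G.analytic_map_closed)+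
  qed (use perm fib in auto)
qed

text \<open>As \<open>fix_count F \<nu>\<close> vanishes once the sum of \<nu> is at least
  \<open>N\<close>, the cycle index is a polynomial \<open>P\<close> in the power sums;
  \<open>power_sum_poly\<close> recovers \<open>P\<close>, and substitution puts \<open>v k\<close>
  for \<open>power_sum k\<close>.\<close>

lemma power_sum_poly_cycle_index:
  fixes v :: "nat \<Rightarrow> num mps"
  assumes F: "\<And>m. m \<ge> N \<Longrightarrow> Struct F {1..m} = {}"
  shows "mps_coeff (poly_subst (power_sum_poly (cycle_index F)) v) \<mu> =
    (\<Sum>m<N. \<Sum>\<nu>\<in>partitions_of m. of_nat (fix_count F \<nu>) / of_nat (z_part \<nu>) * mps_coeff (\<Prod>k\<in>#\<nu>. v k) \<mu>)"
proof -
  let ?K = "\<Union>m\<in>{..<N}. partitions_of m"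
  let ?c = "\<lambda>\<nu>. rat_of_nat (fix_count F \<nu>) / of_nat (z_part \<nu>)"
  define P where "P = (\<Sum>\<nu>\<in>?K. Poly_Mapping.single \<nu> (?c \<nu>))"
  have K: "finite ?K" "?K \<subseteq> partitions" using finite_partitions_of by (auto simp: partitions_of_def)
  have lookup: "Poly_Mapping.lookup P \<nu> = (if \<nu> \<in> ?K then ?c \<nu> else 0)" for \<nu>
    using K(1) unfolding P_def lookup_sum lookup_single by (simp add: when_def)
  then have keys: "Poly_Mapping.keys P \<subseteq> ?K" by (auto simp: in_keys_iff split: if_splits)
  have coeff: "mps_coeff (poly_subst P v) \<mu> = (\<Sum>\<nu>\<in>?K. ?c \<nu> * mps_coeff (\<Prod>k\<in>#\<nu>. v k) \<mu>)"
    for v :: "nat \<Rightarrow> num mps" and \<mu>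
    unfolding coeff_poly_subst[OF K(1) keys] by (rule sum.cong) (auto simp: lookup)
  have "poly_subst P power_sum = cycle_index F"
  proof (rule mps_eqI)
    fix \<mu>
    have "mps_coeff (cycle_index F) \<mu> = (\<Sum>\<nu>\<in>?K. mps_coeff (mps_const (?c \<nu>) * power_sum_part \<nu>) \<mu>)"
      unfolding cycle_index_def
    proof (rule coeff_mps_sum_finite[OF K])
      fix \<nu> assume "\<nu> \<in> partitions - ?K"
      then have "\<Sum>\<^sub># \<nu> \<ge> N" by (auto simp: partitions_of_def)
      then have "fix_count F \<nu> = 0" using F by (simp add: fix_count_def)
      then show "mps_coeff (mps_const (?c \<nu>) * power_sum_part \<nu>) \<mu> = 0" by simp
    qed
    then show "mps_coeff (poly_subst P power_sum) \<mu> = mps_coeff (cycle_index F) \<mu>"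
      by (simp add: coeff power_sum_part_def)
  qed
  then have "power_sum_poly (cycle_index F) = P"
    using keys K by (intro power_sum_poly_eqI) auto
  moreover have "(\<Sum>\<nu>\<in>?K. ?c \<nu> * mps_coeff (\<Prod>k\<in>#\<nu>. v k) \<mu>)
      = (\<Sum>m<N. \<Sum>\<nu>\<in>partitions_of m. ?c \<nu> * mps_coeff (\<Prod>k\<in>#\<nu>. v k) \<mu>)"
    by (rule sum.UNION_disjoint) (auto simp: finite_partitions_of, auto simp: partitions_of_def)
  ultimately show ?thesis using coeff by simp
qed

text \<open>Naturality of the isomorphism at P_x, for the identity on the variables and \<sigma> on
  [n], makes it intertwine both actions of \<sigma>; it therefore restricts to a bijection of fixed
  elements. Equal monomial weights mean equal degrees.\<close>

lemma fix_weight_inner_plethysm: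
  fixes F :: "'f species" and G :: "'g species2" and H :: "'h species2"
  assumes FGH: "is_inner_plethysm F G H" and \<sigma>: "\<sigma> permutes {1..n}"
  shows "fix_weight H n \<sigma> =
    enumerator {E \<in> species_app F (species2_app G UNIV {1..n}).
        species_app_map F (species2_app_map G {1..n} id \<sigma>) E = E}
      (analytic_degree (analytic_degree (\<lambda>i. {#i#})))"
proof -
  have H: "is_species2 H" using FGH by (simp add: is_inner_plethysm_def)
  interpret H: equivariant_family "\<lambda>m. Struct2 H {1..m} {1..n}" "\<lambda>m \<tau>. Transp2 H {1..m} {1..n} \<tau> id"
    "\<lambda>m. Transp2 H {1..m} {1..n} id \<sigma>" "UNIV :: num set" "\<lambda>i. {#i#}" id
    by (rule equivariant_family_species2[OF H \<sigma>])
  let ?HA = "species2_app H (UNIV :: num set) {1..n}" and ?FGA = "species_app F (species2_app G (UNIV :: num set) {1..n})"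
  let ?hH = "species2_app_map H {1..n} (id :: num \<Rightarrow> num) \<sigma>"
    and ?hF = "species_app_map F (species2_app_map G {1..n} (id :: num \<Rightarrow> num) \<sigma>)"
  have sm: "mps_summable UNIV (mps_var :: num \<Rightarrow> num mps)"
    unfolding mps_summable_def
  proof
    fix m :: "num multiset"
    have "{i \<in> UNIV. mps_coeff (mps_var i) m \<noteq> 0} = {i \<in> UNIV. {#i#} = m}"
      by (auto simp: mps_var_eq_monom coeff_monom)
    then show "finite {i \<in> UNIV. mps_coeff (mps_var i) m \<noteq> 0}"
      using finite_fibres_singleton_mset[where 'a = num] unfolding finite_fibres_def by simp
  qed
  have wp: "weight_preserving UNIV (mps_var :: num \<Rightarrow> num mps) UNIV mps_var id"
    by (simp add: weight_preserving_def)
  obtain \<Phi> where \<Phi>: "bij_betw \<Phi> ?HA ?FGA"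
    "\<And>e. e \<in> ?HA \<Longrightarrow> analytic_weight (analytic_weight mps_var) (\<Phi> e) = analytic_weight mps_var e"
    "\<And>e. e \<in> ?HA \<Longrightarrow> \<Phi> (?hH e) = ?hF (\<Phi> e)"
  proof -
    from FGH obtain \<Psi> :: "num set \<Rightarrow> (num \<Rightarrow> num mps) \<Rightarrow> nat set \<Rightarrow>
        ('h, num) analytic \<Rightarrow> ('f, ('g, num) analytic) analytic" where
      bij: "\<forall>A w B. mps_summable A w \<and> finite B \<longrightarrow>
        bij_betw (\<Psi> A w B) (species2_app H A B) (species_app F (species2_app G A B)) \<and>
        (\<forall>e\<in>species2_app H A B.
          analytic_weight (analytic_weight w) (\<Psi> A w B e) = analytic_weight w e)" and
      nat: "\<forall>A w A' w' h B B' \<beta>.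
        mps_summable A w \<and> mps_summable A' w' \<and> weight_preserving A w A' w' h \<and>
        finite B \<and> bij_betw \<beta> B B' \<longrightarrow>
        (\<forall>e\<in>species2_app H A B.
          \<Psi> A' w' B' (species2_app_map H B h \<beta> e) =
          species_app_map F (species2_app_map G B h \<beta>) (\<Psi> A w B e))"
      unfolding is_inner_plethysm_def by (elim conjE exE) (rule that)
    note \<Psi> = bij[rule_format, of UNIV mps_var "{1..n}"]
      nat[rule_format, of UNIV mps_var UNIV mps_var id "{1..n}" \<sigma> "{1..n}"]
    show ?thesis
      by (rule that[of "\<Psi> UNIV mps_var {1..n}"])
        (use \<Psi> sm wp permutes_imp_bij[OF \<sigma>] in simp_all)
  qed
  have deg: "analytic_degree (analytic_degree (\<lambda>i. {#i#})) (\<Phi> e) = analytic_degree (\<lambda>i. {#i#}) e" if "e \<in> ?HA" for e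
    using \<Phi>(2)[OF that] by (simp add: analytic_weight_var analytic_weight_monom)
  have closed: "?hH e \<in> ?HA" if "e \<in> ?HA" for e
    using that H.analytic_map_closed(1) unfolding species2_app_def species2_app_map_def by blast
  have inj: "inj_on \<Phi> ?HA" and img: "\<Phi> ` ?HA = ?FGA" using \<Phi>(1) by (auto simp: bij_betw_def)
  have iff: "?hF (\<Phi> e) = \<Phi> e \<longleftrightarrow> ?hH e = e" if "e \<in> ?HA" for e
    using \<Phi>(3)[OF that, symmetric] inj_on_eq_iff[OF inj closed[OF that] that] by simp
  have "\<Phi> ` {e \<in> ?HA. ?hH e = e} = {E \<in> ?FGA. ?hF E = E}"
  proof (intro equalityI subsetI)
    fix E assume E: "E \<in> {E \<in> ?FGA. ?hF E = E}"
    then obtain e where "e \<in> ?HA" "E = \<Phi> e" using img by blast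
    with E iff show "E \<in> \<Phi> ` {e \<in> ?HA. ?hH e = e}" by auto
  qed (use iff img in auto)
  then have "bij_betw \<Phi> {e \<in> ?HA. ?hH e = e} {E \<in> ?FGA. ?hF E = E}"
    using inj by (auto simp: bij_betw_def intro: inj_on_subset)
  then show ?thesis
    unfolding fix_weight_eq_enumerator by (rule enumerator_reindex) (simp add: deg)
qed

theorem lemma2p20:
  fixes F :: "'f species" and G :: "'g species2" and H :: "'h species2"
    and n :: nat and \<chi> :: "(nat \<Rightarrow> nat) \<Rightarrow> num mps"
  assumes "is_species F" and "strictly_finite F"
    and "is_species2 G"
    and "is_inner_plethysm F G H"
    and \<chi>: "\<And>\<sigma>. \<sigma> permutes {1..n} \<Longrightarrow> \<chi> \<sigma> = fix_weight G n \<sigma>"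
  shows "class_function n \<chi> \<and>
    (\<forall>\<sigma>. \<sigma> permutes {1..n} \<longrightarrow>
       \<chi> \<sigma> = mps_sum partitions
         (\<lambda>\<nu>. mps_const (of_nat (fix_count2 G \<nu> (cycle_type n \<sigma>)) / of_nat (z_part \<nu>))
               * power_sum_part \<nu>)) \<and>
    (\<forall>\<sigma>. \<sigma> permutes {1..n} \<longrightarrow> fix_weight H n \<sigma> = plethysm (cycle_index F) \<chi> \<sigma>)"
proof (intro conjI allI impI)
  show "class_function n \<chi>" by (rule class_function_fix_weight[OF assms(3) \<chi>])
next
  fix \<sigma> assume \<sigma>: "\<sigma> permutes {1..n}"
  show "\<chi> \<sigma> = mps_sum partitions
      (\<lambda>\<nu>. mps_const (of_nat (fix_count2 G \<nu> (cycle_type n \<sigma>)) / of_nat (z_part \<nu>)) * power_sum_part \<nu>)"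
    unfolding \<chi>[OF \<sigma>] by (rule fix_weight_eq_sum[OF assms(3) \<sigma>])
next
  fix \<sigma> assume \<sigma>: "\<sigma> permutes {1..n}"
  obtain N where N: "\<And>m. m \<ge> N \<Longrightarrow> Struct F {1..m} = {}"
    using assms(2) by (auto simp: strictly_finite_def)
  interpret FG: equivariant_family "\<lambda>m. Struct F {1..m}" "\<lambda>m. Transp F {1..m}" "\<lambda>_ t. t"
    "species2_app G (UNIV :: num set) {1..n}" "analytic_degree (\<lambda>i. {#i#})" "species2_app_map G {1..n} id \<sigma>"
    by (rule equivariant_family_species[OF assms(1,3) \<sigma>])
  show "fix_weight H n \<sigma> = plethysm (cycle_index F) \<chi> \<sigma>"
  proof (rule mps_eqI)
    fix \<mu>
    let ?D = "{E \<in> species_app F (species2_app G UNIV {1..n}).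
        species_app_map F (species2_app_map G {1..n} id \<sigma>) E = E}"
    \<comment> \<open>The k-th iterate is the action of \<open>\<sigma> ^^ k\<close>, so its fixed
      points have the series \<open>\<chi> (\<sigma> ^^ k)\<close>; counting degrees
      \<open>k\<close> times is the substitution of k-th powers.\<close>
    have adams: "FG.cycle_weight k = adams k \<chi> \<sigma>" if "k > 0" for k
    proof -
      have "{e \<in> species2_app G UNIV {1..n}. (species2_app_map G {1..n} id \<sigma> ^^ k) e = e}
          = {e \<in> species2_app G (UNIV :: num set) {1..n}. species2_app_map G {1..n} id (\<sigma> ^^ k) e = e}"
        using funpow_species2_app_map[OF assms(3) \<sigma>] by (intro Collect_cong) auto
      then show ?thesis
        by (simp only: adams_def \<chi>[OF permutes_funpow[OF \<sigma>]] fix_weight_eq_enumerator pth_plethysm_enumerator[OF that])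
    qed
    \<comment> \<open>Elements of G(P_x, [n]) may have degree zero, so the degree \<mu> alone does
      not bound \<open>m\<close>; strict finiteness does, as there are no structures of
      \<open>F\<close> on [m] for \<open>m \<ge> N\<close>.\<close>
    have split: "{E \<in> ?D. analytic_degree (analytic_degree (\<lambda>i. {#i#})) E = \<mu>} =
        (\<Union>m\<in>{..<N}. FG.fixed_of_degree m \<mu>)"
      using N by (auto simp: species_app_def species_app_map_def analytic_set_def not_le[symmetric])
    have "finite (FG.fixed_of_degree m \<mu>)" for m
      by (rule finite_subset[OF _ FG.finite_of_degree[of m \<mu>]]) auto
    then have "card (\<Union>m\<in>{..<N}. FG.fixed_of_degree m \<mu>) = (\<Sum>m<N. card (FG.fixed_of_degree m \<mu>))"
      by (intro card_UN_disjoint) auto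
    then have "mps_coeff (fix_weight H n \<sigma>) \<mu> = (\<Sum>m<N. of_nat (card (FG.fixed_of_degree m \<mu>)))"
      unfolding fix_weight_inner_plethysm[OF assms(4) \<sigma>] coeff_enumerator split by simp
    also have "\<dots> = (\<Sum>m<N. \<Sum>\<nu>\<in>partitions_of m. of_nat (fix_count F \<nu>) / of_nat (z_part \<nu>) *
        mps_coeff (\<Prod>k\<in>#\<nu>. FG.cycle_weight k) \<mu>)"
      by (intro sum.cong refl FG.card_fixed_of_degree_by_type card_fixed_species[OF assms(1)])
    also have "\<dots> = (\<Sum>m<N. \<Sum>\<nu>\<in>partitions_of m. of_nat (fix_count F \<nu>) / of_nat (z_part \<nu>) *
        mps_coeff (\<Prod>k\<in>#\<nu>. adams k \<chi> \<sigma>) \<mu>)"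
    proof (intro sum.cong refl)
      \<comment> \<open>Parts of a partition are positive, as the identification of the factors with
        Adams operations requires.\<close>
      fix m \<nu> assume "\<nu> \<in> partitions_of m"
      then have "image_mset FG.cycle_weight \<nu> = image_mset (\<lambda>k. adams k \<chi> \<sigma>) \<nu>"
        by (intro image_mset_cong adams) (auto simp: partitions_of_def partitions_pos)
      then show "of_nat (fix_count F \<nu>) / of_nat (z_part \<nu>) * mps_coeff (\<Prod>k\<in>#\<nu>. FG.cycle_weight k) \<mu>
          = of_nat (fix_count F \<nu>) / of_nat (z_part \<nu>) * mps_coeff (\<Prod>k\<in>#\<nu>. adams k \<chi> \<sigma>) \<mu>"
        by (simp only:)
    qed
    also have "\<dots> = mps_coeff (plethysm (cycle_index F) \<chi> \<sigma>) \<mu>"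
      unfolding plethysm_def by (rule power_sum_poly_cycle_index[OF N, symmetric])
    finally show "mps_coeff (fix_weight H n \<sigma>) \<mu> = mps_coeff (plethysm (cycle_index F) \<chi> \<sigma>) \<mu>" .
  qed
qed

end
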